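(* Let $A$ be a $\sigma$-finite von Neumann algebra, let $k_1,\dots,k_n\in A$, and let $W_2$ be the associated Wasserstein distance on the set $\mathfrak{F}(A)$ of faithful normal states on $A$. Then $$W_2(\mu,\mu)=0$$ for all $\mu\in\mathfrak{F}(A)$.
   Context: Inner products are linear in the second variable. $\mathfrak{F}(A)$ denotes the set of faithful normal states on the von Neumann algebra $A$. Take $A$ in standard form on a Hilbert space $G$; each $\mu\in\mathfrak{F}(A)$ is represented by a cyclic and separating vector $\Lambda_\mu\in G$ for $A$, i.e. $\mu(a)=\langle\Lambda_\mu,a\Lambda_\mu\rangle$ for $a\in A$. On the commutant $A'$ one defines the state $\mu'(a')=\langle\Lambda_\mu,a'\Lambda_\mu\rangle$. Let $\sigma^\mu$ denote the modular group of $A$ associated with $\mu$. Transport plans: for $\mu,\nu\in\mathfrak{F}(A)$, a transport plan from $\mu$ to $\nu$ is a state $\omega$ on the algebraic tensor product $A\odot A'$ with $\omega(a\otimes 1)=\mu(a)$ and $\omega(1\otimes a')=\nu'(a')$ for all $a\in A$, $a'\in A'$; $T(\mu,\nu)$ is the set of these. For a unital completely positive map $\beta:A\to A$ with $\nu\circ\beta=\nu$, its dual $\beta':A'\to A'$ is defined by $\langle\Lambda_\nu,b\beta'(b')\Lambda_\nu\rangle=\langle\Lambda_\nu,\beta(b)b'\Lambda_\nu\rangle$ for all $b\in A$, $b'\in A'$. The set $T_\sigma(\mu,\nu)$ of modular transport plans consists of those $\omega\in T(\mu,\nu)$ with $\omega(\sigma_t^\mu(a)\otimes b')=\omega(a\otimes(\sigma_t^\nu)'(b'))$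 for all $a\in A$, $b'\in A'$, $t\in\mathbb{R}$. Cost: for $\omega\in T(\mu,\nu)$ let $(H_\omega,\pi_\omega,\Omega)$ be a cyclic representation of $(A\odot A',\omega)$, i.e. $\Omega$ is cyclic and $\omega=\langle\Omega,\pi_\omega(\cdot)\Omega\rangle_\omega$; $\|\cdot\|_\omega$ is the norm of $H_\omega$. Put $\pi_\mu^\omega(a)=\pi_\omega(a\otimes1)|_{H_\mu^\omega}$ for $a\in A$, where $H_\mu^\omega=\overline{\pi_\omega(A\otimes1)\Omega}$. Let $H_\nu^\omega=\overline{\pi_\omega(1\otimes A')\Omega}$, let $u_\nu:G\to H_\nu^\omega$ be the unitary determined by $u_\nu a'\Lambda_\nu=\pi_\omega(1\otimes a')\Omega$ for $a'\in A'$, and put $\pi_\nu^\omega(b)=u_\nu bu_\nu^*$ for $b\in A$. (For $\nu=\mu$ the two representations so obtained, of the source state via $\pi_\omega(a\otimes 1)$ and of the target state via $u_\nu$, are distinguished by their role.) Given $k_1,\dots,k_n\in A$, the cost of $\omega$ is $I(\omega)=\sum_{l=1}^n\|\pi_\mu^\omega(k_l)\Omega-\pi_\nu^\omega(k_l)\Omega\|_\omega^2$. The Wasserstein distance associated to $k_1,\dots,k_n$ is $W_2(\mu,\nu)=\inf_{\omega\in T_\sigma(\mu,\nu)}I(\omega)^{1/2}$ for $\mu,\nu\in\mathfrak{F}(A)$. *)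

theory Defs
  imports "HOL-Analysis.Analysis" "HOL-Library.Function_Algebras"
begin

section \<open>Complex Hilbert spaces\<close>

class complex_vector = ab_group_add +
  fixes scaleC :: "complex \<Rightarrow> 'a \<Rightarrow> 'a" (infixr "*\<^sub>C" 75)
  assumes scaleC_add_right: "c *\<^sub>C (x + y) = c *\<^sub>C x + c *\<^sub>C y"
    and scaleC_add_left: "(c + d) *\<^sub>C x = c *\<^sub>C x + d *\<^sub>C x"
    and scaleC_scaleC: "c *\<^sub>C d *\<^sub>C x = (c * d) *\<^sub>C x"
    and scaleC_one: "1 *\<^sub>C x = x"

text \<open>The real inner product inherited from \<^class>\<open>real_inner\<close>, hence also the norm and the
  topology, are those induced by the complex inner product, which is linear in its second variable.\<close>

class chilbert_space = complex_vector + real_inner + complete_space +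
  fixes cinner :: "'a \<Rightarrow> 'a \<Rightarrow> complex"
  assumes scaleR_scaleC: "r *\<^sub>R x = complex_of_real r *\<^sub>C x"
    and cinner_commute: "cinner x y = cnj (cinner y x)"
    and cinner_add_right: "cinner x (y + z) = cinner x y + cinner x z"
    and cinner_scaleC_right: "cinner x (c *\<^sub>C y) = c * cinner x y"
    and inner_eq_Re_cinner: "inner x y = Re (cinner x y)"

instantiation complex :: chilbert_space
begin
definition scaleC_complex :: "complex \<Rightarrow> complex \<Rightarrow> complex" where "scaleC_complex c x = c * x"
definition cinner_complex :: "complex \<Rightarrow> complex \<Rightarrow> complex" where "cinner_complex x y = cnj x * y"
instance
  by standard (auto simp: scaleC_complex_def cinner_complex_def algebra_simps inner_complex_def
      scaleR_conv_of_real)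
end

instantiation "fun" :: (type, complex_vector) complex_vector
begin
definition scaleC_fun :: "complex \<Rightarrow> ('a \<Rightarrow> 'b) \<Rightarrow> 'a \<Rightarrow> 'b" where
  "scaleC_fun c f = (\<lambda>x. c *\<^sub>C f x)"
instance
  by standard (auto simp: scaleC_fun_def fun_eq_iff scaleC_add_right scaleC_add_left
      scaleC_scaleC scaleC_one)
end

lemma scaleC_zero_right: "c *\<^sub>C (0::'a::complex_vector) = 0"
  using scaleC_add_right[of c "0::'a" 0] by simp

lemma scaleC_minus_right: "c *\<^sub>C (- x) = - (c *\<^sub>C (x::'a::complex_vector))"
proof -
  have "c *\<^sub>C (- x) + c *\<^sub>C x = 0"
    unfolding scaleC_add_right[symmetric] by (simp add: scaleC_zero_right)
  then show ?thesis by (rule eq_neg_iff_add_eq_0[THEN iffD2])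
qed

lemma bounded_linear_scaleC: "bounded_linear ((*\<^sub>C) c :: 'a \<Rightarrow> 'a::chilbert_space)"
proof (rule bounded_linear_intro[where K = "cmod c"])
  fix x y :: 'a and r :: real
  show "c *\<^sub>C (x + y) = c *\<^sub>C x + c *\<^sub>C y" by (rule scaleC_add_right)
  show "c *\<^sub>C r *\<^sub>R x = r *\<^sub>R c *\<^sub>C x"
    by (simp add: scaleR_scaleC scaleC_scaleC mult.commute)
  have left: "cinner (c *\<^sub>C x) y = cnj c * cinner x y" for y :: 'a
    by (metis cinner_commute cinner_scaleC_right complex_cnj_mult)
  have "Im (cinner x x) = 0"
    by (metis cinner_commute cnj.simps(2) equal_neg_zero)
  then have "inner (c *\<^sub>C x) (c *\<^sub>C x) = (cmod c)\<^sup>2 * inner x x"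
    unfolding cmod_power2
    by (simp add: inner_eq_Re_cinner left cinner_scaleC_right algebra_simps power2_eq_square)
  then show "norm (c *\<^sub>C x) \<le> norm x * cmod c"
    by (simp add: norm_eq_sqrt_inner real_sqrt_mult mult.commute)
qed

definition csubspace :: "'a::complex_vector set \<Rightarrow> bool" where
  "csubspace S \<longleftrightarrow> 0 \<in> S \<and> (\<forall>x\<in>S. \<forall>y\<in>S. x + y \<in> S) \<and> (\<forall>c. \<forall>x\<in>S. c *\<^sub>C x \<in> S)"

definition clinear_on :: "'a::complex_vector set \<Rightarrow> ('a \<Rightarrow> 'b::complex_vector) \<Rightarrow> bool" where
  "clinear_on S f \<longleftrightarrow>
     (\<forall>x\<in>S. \<forall>y\<in>S. f (x + y) = f x + f y) \<and> (\<forall>c. \<forall>x\<in>S. f (c *\<^sub>C x) = c *\<^sub>C f x)"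

section \<open>Bounded operators\<close>

typedef (overloaded) 'a cop =
  "{f :: 'a::chilbert_space \<Rightarrow> 'a. bounded_linear f \<and> (\<forall>c x. f (c *\<^sub>C x) = c *\<^sub>C f x)}"
  morphisms cop_apply Cop
  by (rule exI[of _ id]) (auto simp: id_def)

notation cop_apply (infixr "\<cdot>" 76)

setup_lifting type_definition_cop

lemma cop_eqI: "(\<And>x. a \<cdot> x = b \<cdot> x) \<Longrightarrow> a = b"
  by (simp add: cop_apply_inject[symmetric] fun_eq_iff)

text \<open>The product of operators is composition, and \<open>1\<close> is the identity operator.\<close>

instantiation cop :: (chilbert_space) "{complex_vector, ring, monoid_mult}"
begin
lift_definition zero_cop :: "'a cop" is "\<lambda>x. 0"
  by (simp add: scaleC_zero_right)
lift_definition one_cop :: "'a cop" is "\<lambda>x. x"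
  by simp
lift_definition plus_cop :: "'a cop \<Rightarrow> 'a cop \<Rightarrow> 'a cop" is "\<lambda>f g x. f x + g x"
  by (auto simp: scaleC_add_right intro: bounded_linear_add)
lift_definition uminus_cop :: "'a cop \<Rightarrow> 'a cop" is "\<lambda>f x. - f x"
  by (auto simp: scaleC_minus_right intro: bounded_linear_minus)
lift_definition minus_cop :: "'a cop \<Rightarrow> 'a cop \<Rightarrow> 'a cop" is "\<lambda>f g x. f x - g x"
  by (auto simp: scaleC_minus_right scaleC_add_right diff_conv_add_uminus
      simp del: add_uminus_conv_diff intro: bounded_linear_add bounded_linear_minus)
lift_definition times_cop :: "'a cop \<Rightarrow> 'a cop \<Rightarrow> 'a cop" is "\<lambda>f g x. f (g x)"
  by (auto intro: bounded_linear_compose)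
lift_definition scaleC_cop :: "complex \<Rightarrow> 'a cop \<Rightarrow> 'a cop" is "\<lambda>c f x. c *\<^sub>C f x"
  by (auto simp: scaleC_scaleC mult.commute
      intro: bounded_linear_compose[OF bounded_linear_scaleC])
instance
proof
  fix a b c :: "'a cop" and r s :: complex
  have add: "a \<cdot> (x + y) = a \<cdot> x + a \<cdot> y" for x y
    using cop_apply[of a] by (simp add: bounded_linear.linear linear_add)
  show "a * (b + c) = a * b + a * c"
    by (rule cop_eqI) (simp add: times_cop.rep_eq plus_cop.rep_eq add)
  show "a + b + c = a + (b + c)" by transfer (simp add: add.assoc)
  show "a + b = b + a" by transfer (simp add: add.commute)
  show "0 + a = a" by transfer simp
  show "- a + a = 0" by transfer simp
  show "a - b = a + - b" by transfer simp
  show "r *\<^sub>C (a + b) = r *\<^sub>C a + r *\<^sub>C b" by transfer (simp add: scaleC_add_right)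
  show "(r + s) *\<^sub>C a = r *\<^sub>C a + s *\<^sub>C a" by transfer (simp add: scaleC_add_left)
  show "r *\<^sub>C s *\<^sub>C a = (r * s) *\<^sub>C a" by transfer (simp add: scaleC_scaleC)
  show "1 *\<^sub>C a = a" by transfer (simp add: scaleC_one)
  show "a * b * c = a * (b * c)" by transfer simp
  show "(a + b) * c = a * c + b * c" by transfer simp
  show "1 * a = a" by transfer simp
  show "a * 1 = a" by transfer simp
qed
end

definition adj :: "'a::chilbert_space cop \<Rightarrow> 'a cop" where
  "adj a = (THE b :: 'a cop. \<forall>x y. cinner (a \<cdot> x) y = cinner x (b \<cdot> y))"

definition pos_op :: "'a::chilbert_space cop \<Rightarrow> bool" where
  "pos_op a \<longleftrightarrow> (\<forall>x. cinner x (a \<cdot> x) \<in> \<real>\<^sub>\<ge>\<^sub>0)"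

definition projection :: "'a::chilbert_space cop \<Rightarrow> bool" where
  "projection p \<longleftrightarrow> p * p = p \<and> adj p = p"

section \<open>Von Neumann algebras, standard form, faithful normal states\<close>

definition commutant :: "'a::chilbert_space cop set \<Rightarrow> 'a cop set" where
  "commutant A = {b. \<forall>a\<in>A. a * b = b * a}"

definition von_neumann_algebra :: "'a::chilbert_space cop set \<Rightarrow> bool" where
  "von_neumann_algebra A \<longleftrightarrow> adj ` A \<subseteq> A \<and> commutant (commutant A) = A"

definition sigma_finite :: "'a::chilbert_space cop set \<Rightarrow> bool" where
  "sigma_finite A \<longleftrightarrow>
     (\<forall>Q\<subseteq>A. (\<forall>p\<in>Q. projection p \<and> p \<noteq> 0) \<and> (\<forall>p\<in>Q. \<forall>q\<in>Q. p \<noteq> q \<longrightarrow> p * q = 0)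
        \<longrightarrow> countable Q)"

text \<open>Haagerup's axioms for a standard form \<open>(A, G, J, P)\<close>, where \<open>G\<close> is the Hilbert space of the
  type \<open>'a\<close>: \<open>J\<close> is a conjugate linear isometric involution and \<open>P\<close> a self-dual cone.
  \<open>conj_by J a\<close> is the operator \<open>J a J\<close>.\<close>

definition conj_by :: "('a \<Rightarrow> 'a) \<Rightarrow> 'a::chilbert_space cop \<Rightarrow> 'a cop" where
  "conj_by J a = Cop (\<lambda>x. J (a \<cdot> J x))"

definition standard_form ::
    "'a::chilbert_space cop set \<Rightarrow> ('a \<Rightarrow> 'a) \<Rightarrow> 'a set \<Rightarrow> bool" where
  "standard_form A J P \<longleftrightarrow>
     (\<forall>x y. J (x + y) = J x + J y) \<and> (\<forall>c x. J (c *\<^sub>C x) = cnj c *\<^sub>C J x) \<and>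
     (\<forall>x y. cinner (J x) (J y) = cinner y x) \<and> (\<forall>x. J (J x) = x) \<and>
     P = {x. \<forall>y\<in>P. cinner x y \<in> \<real>\<^sub>\<ge>\<^sub>0} \<and>
     conj_by J ` A = commutant A \<and>
     (\<forall>z\<in>A \<inter> commutant A. conj_by J z = adj z) \<and>
     (\<forall>x\<in>P. J x = x) \<and>
     (\<forall>a\<in>A. \<forall>x\<in>P. (a * conj_by J a) \<cdot> x \<in> P)"

definition state_on :: "'a::chilbert_space cop set \<Rightarrow> ('a cop \<Rightarrow> complex) \<Rightarrow> bool" where
  "state_on A \<mu> \<longleftrightarrow> clinear_on A \<mu> \<and> (\<forall>a\<in>A. \<mu> (adj a * a) \<in> \<real>\<^sub>\<ge>\<^sub>0) \<and> \<mu> 1 = 1"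

text \<open>Normality: the state preserves the least upper bounds of bounded increasing nets of positive
  elements, here of upwards directed sets \<open>D\<close> with least upper bound \<open>s\<close>.\<close>

definition normal_on :: "'a::chilbert_space cop set \<Rightarrow> ('a cop \<Rightarrow> complex) \<Rightarrow> bool" where
  "normal_on A \<mu> \<longleftrightarrow>
     (\<forall>D s. D \<subseteq> A \<and> D \<noteq> {} \<and> (\<forall>a\<in>D. pos_op a) \<and>
        (\<forall>a\<in>D. \<forall>b\<in>D. \<exists>c\<in>D. pos_op (c - a) \<and> pos_op (c - b)) \<and>
        s \<in> A \<and> (\<forall>a\<in>D. pos_op (s - a)) \<and>
        (\<forall>u\<in>A. (\<forall>a\<in>D. pos_op (u - a)) \<longrightarrow> pos_op (u - s))
        \<longrightarrow> Re (\<mu> s) = (SUP a\<in>D. Re (\<mu> a)))"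

definition faithful_normal_states ::
    "'a::chilbert_space cop set \<Rightarrow> ('a cop \<Rightarrow> complex) set" where
  "faithful_normal_states A =
     {\<mu> \<in> extensional A. state_on A \<mu> \<and> normal_on A \<mu> \<and> (\<forall>a\<in>A. \<mu> (adj a * a) = 0 \<longrightarrow> a = 0)}"

definition cyclic_vector :: "'a::chilbert_space cop set \<Rightarrow> 'a \<Rightarrow> bool" where
  "cyclic_vector A v \<longleftrightarrow> closure ((\<lambda>a. a \<cdot> v) ` A) = UNIV"

definition separating_vector :: "'a::chilbert_space cop set \<Rightarrow> 'a \<Rightarrow> bool" where
  "separating_vector A v \<longleftrightarrow> (\<forall>a\<in>A. a \<cdot> v = 0 \<longrightarrow> a = 0)"

definition represents ::
    "'a::chilbert_space cop set \<Rightarrow> ('a cop \<Rightarrow> complex) \<Rightarrow> 'a \<Rightarrow> bool" where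
  "represents A \<mu> v \<longleftrightarrow>
     cyclic_vector A v \<and> separating_vector A v \<and> (\<forall>a\<in>A. \<mu> a = cinner v (a \<cdot> v))"

section \<open>The modular group\<close>

text \<open>Unbounded operators are given by their graphs. \<open>tomita A v\<close> is the closure of the conjugate
  linear operator \<open>a v \<mapsto> a\<^sup>* v\<close>; its adjoint satisfies \<open>\<langle>y, S x\<rangle> = \<langle>x, S\<^sup>* y\<rangle>\<close>.\<close>

definition tomita :: "'a::chilbert_space cop set \<Rightarrow> 'a \<Rightarrow> ('a \<times> 'a) set" where
  "tomita A v = closure {(a \<cdot> v, adj a \<cdot> v) | a. a \<in> A}"

definition antilinear_adjoint :: "('a::chilbert_space \<times> 'a) set \<Rightarrow> ('a \<times> 'a) set" where
  "antilinear_adjoint S = {(y, z). \<forall>(x, w)\<in>S. cinner y w = cinner x z}"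

definition modular_operator :: "'a::chilbert_space cop set \<Rightarrow> 'a \<Rightarrow> ('a \<times> 'a) set" where
  "modular_operator A v = tomita A v O antilinear_adjoint (tomita A v)"

definition projection_valued_measure :: "(real set \<Rightarrow> 'a::chilbert_space cop) \<Rightarrow> bool" where
  "projection_valued_measure E \<longleftrightarrow>
     (\<forall>B\<in>sets borel. projection (E B)) \<and> E UNIV = 1 \<and>
     (\<forall>F x. disjoint_family F \<and> range F \<subseteq> sets borel
        \<longrightarrow> (\<lambda>i::nat. E (F i) \<cdot> x) sums (E (\<Union>i. F i) \<cdot> x))"

definition spectral_distribution ::
    "(real set \<Rightarrow> 'a::chilbert_space cop) \<Rightarrow> 'a \<Rightarrow> real measure" where
  "spectral_distribution E x =
     measure_of UNIV (sets borel) (\<lambda>B. ennreal (Re (cinner x (E B \<cdot> x))))"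

text \<open>\<open>R = \<integral> \<lambda> dE(\<lambda>)\<close> for the graph \<open>R\<close> of a self-adjoint operator. By polarization it
  suffices to compare the quadratic forms on the common domain.\<close>

definition spectral_resolution ::
    "(real set \<Rightarrow> 'a::chilbert_space cop) \<Rightarrow> ('a \<times> 'a) set \<Rightarrow> bool" where
  "spectral_resolution E R \<longleftrightarrow>
     projection_valued_measure E \<and>
     Domain R = {x. integrable (spectral_distribution E x) (\<lambda>l. l\<^sup>2)} \<and>
     (\<forall>(x, y)\<in>R. cinner x y = complex_of_real (LINT l|spectral_distribution E x. l))"

text \<open>The unitary \<open>\<Delta>\<^sup>i\<^sup>t\<close>, again determined by its quadratic form. As \<open>\<Delta>\<close> is positive and
  injective, its spectral measure lives on \<open>(0, \<infinity>)\<close>, where \<open>l powr (i t) = exp (i t ln l)\<close>.\<close>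

definition modular_unitary :: "'a::chilbert_space cop set \<Rightarrow> 'a \<Rightarrow> real \<Rightarrow> 'a cop" where
  "modular_unitary A v t =
     (THE U :: 'a cop. \<exists>E. spectral_resolution E (modular_operator A v) \<and>
        (\<forall>x. cinner x (U \<cdot> x) =
           (LINT l|spectral_distribution E x. complex_of_real l powr (\<i> * complex_of_real t))))"

definition modular_group ::
    "'a::chilbert_space cop set \<Rightarrow> 'a \<Rightarrow> real \<Rightarrow> 'a cop \<Rightarrow> 'a cop" where
  "modular_group A v t a = modular_unitary A v t * a * modular_unitary A v (- t)"

text \<open>\<open>\<beta>'\<close> is the dual \<open>A' \<rightarrow> A'\<close> of \<open>\<beta> : A \<rightarrow> A\<close> with respect to the state represented by \<open>v\<close>.
  When \<open>v\<close> is cyclic for \<open>A\<close>, hence separating for \<open>A'\<close>, this determines \<open>\<beta>'\<close> on \<open>A'\<close>.\<close>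

definition is_dual ::
    "'a::chilbert_space cop set \<Rightarrow> 'a \<Rightarrow> ('a cop \<Rightarrow> 'a cop) \<Rightarrow> ('a cop \<Rightarrow> 'a cop) \<Rightarrow> bool" where
  "is_dual A v \<beta> \<beta>' \<longleftrightarrow>
     (\<forall>b'\<in>commutant A. \<beta>' b' \<in> commutant A \<and>
        (\<forall>b\<in>A. cinner v (b \<cdot> \<beta>' b' \<cdot> v) = cinner v (\<beta> b \<cdot> b' \<cdot> v)))"

section \<open>The algebraic tensor product\<close>

text \<open>The algebraic tensor product is realised as the span of the evaluation functionals
  \<open>a \<otimes> b : B \<mapsto> B(a, b)\<close> on the space of bilinear forms; accordingly a tensor is a function of
  bilinear forms, with value \<open>0\<close> on functions that are not bilinear. The linear functional which a
  bilinear form \<open>B\<close> induces on tensors is evaluation at \<open>B\<close>. Since bilinear forms extend from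
  subspaces, the algebraic tensor product of subspaces \<open>S\<close> and \<open>T\<close> is the span of the \<open>a \<otimes> b\<close> with
  \<open>a \<in> S\<close> and \<open>b \<in> T\<close>.\<close>

type_synonym ('a, 'b) tensor = "('a \<Rightarrow> 'b \<Rightarrow> complex) \<Rightarrow> complex"

definition bilinear_form :: "('a::complex_vector \<Rightarrow> 'b::complex_vector \<Rightarrow> complex) \<Rightarrow> bool" where
  "bilinear_form B \<longleftrightarrow> (\<forall>b. clinear_on UNIV (\<lambda>a. B a b)) \<and> (\<forall>a. clinear_on UNIV (B a))"

definition tens :: "'a::complex_vector \<Rightarrow> 'b::complex_vector \<Rightarrow> ('a, 'b) tensor" (infixr "\<otimes>" 76) where
  "a \<otimes> b = (\<lambda>B. if bilinear_form B then B a b else 0)"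

definition alg_tensor ::
    "'a::complex_vector set \<Rightarrow> 'b::complex_vector set \<Rightarrow> ('a, 'b) tensor set" where
  "alg_tensor S T = {(\<Sum>i<m. a i \<otimes> b i) | (m::nat) a b. \<forall>i<m. a i \<in> S \<and> b i \<in> T}"

text \<open>Product and involution, the bilinear and conjugate linear extensions of
  \<open>(a \<otimes> b)(c \<otimes> d) = ac \<otimes> bd\<close> and \<open>(a \<otimes> b)\<^sup>* = a\<^sup>* \<otimes> b\<^sup>*\<close>.\<close>

definition tmult :: "('a::chilbert_space cop, 'b::chilbert_space cop) tensor \<Rightarrow>
    ('a cop, 'b cop) tensor \<Rightarrow> ('a cop, 'b cop) tensor" where
  "tmult s t = (\<lambda>B. if bilinear_form B then s (\<lambda>a b. t (\<lambda>c d. B (a * c) (b * d))) else 0)"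

lemma tmult_tens:
  fixes a c :: "'a::chilbert_space cop" and b d :: "'b::chilbert_space cop"
  shows "tmult (a \<otimes> b) (c \<otimes> d) = (a * c) \<otimes> (b * d)"
proof
  fix B :: "'a cop \<Rightarrow> 'b cop \<Rightarrow> complex"
  have right: "a * (r *\<^sub>C c) = r *\<^sub>C (a * c)" for r and a c :: "'x::chilbert_space cop"
    using cop_apply[of a] by (intro cop_eqI) (simp add: times_cop.rep_eq scaleC_cop.rep_eq)
  have left: "(r *\<^sub>C a) * c = r *\<^sub>C (a * c)" for r and a c :: "'x::chilbert_space cop"
    by (intro cop_eqI) (simp add: times_cop.rep_eq scaleC_cop.rep_eq)
  show "tmult (a \<otimes> b) (c \<otimes> d) B = ((a * c) \<otimes> (b * d)) B"
  proof (cases "bilinear_form B")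
    case True
    then have "bilinear_form (\<lambda>c d. B (a * c) (b * d))" for a b
      by (simp add: bilinear_form_def clinear_on_def right distrib_left)
    moreover from True have "bilinear_form (\<lambda>a b. B (a * c) (b * d))" for c d
      by (simp add: bilinear_form_def clinear_on_def left distrib_right)
    ultimately show ?thesis using True by (simp add: tmult_def tens_def)
  qed (simp add: tmult_def tens_def)
qed

definition tstar :: "('a::chilbert_space cop, 'b::chilbert_space cop) tensor \<Rightarrow>
    ('a cop, 'b cop) tensor" where
  "tstar t = (\<lambda>B. if bilinear_form B then cnj (t (\<lambda>a b. cnj (B (adj a) (adj b)))) else 0)"

section \<open>Transport plans\<close>

text \<open>A state on \<open>A \<odot> A'\<close> is given by a function on all tensors of which only the values on
  \<open>A \<odot> A'\<close> matter.\<close>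

definition tensor_state ::
    "'a::chilbert_space cop set \<Rightarrow> (('a cop, 'a cop) tensor \<Rightarrow> complex) \<Rightarrow> bool" where
  "tensor_state A \<omega> \<longleftrightarrow>
     clinear_on (alg_tensor A (commutant A)) \<omega> \<and>
     (\<forall>t\<in>alg_tensor A (commutant A). \<omega> (tmult (tstar t) t) \<in> \<real>\<^sub>\<ge>\<^sub>0) \<and> \<omega> (1 \<otimes> 1) = 1"

text \<open>In the following \<open>\<Lambda> \<nu>\<close> is the chosen vector representing \<open>\<nu>\<close>, so that
  \<open>\<nu>'(a') = \<langle>\<Lambda> \<nu>, a' (\<Lambda> \<nu>)\<rangle>\<close>.\<close>

definition transport_plans ::
    "'a::chilbert_space cop set \<Rightarrow> (('a cop \<Rightarrow> complex) \<Rightarrow> 'a) \<Rightarrow>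
     ('a cop \<Rightarrow> complex) \<Rightarrow> ('a cop \<Rightarrow> complex) \<Rightarrow> (('a cop, 'a cop) tensor \<Rightarrow> complex) set" where
  "transport_plans A \<Lambda> \<mu> \<nu> =
     {\<omega>. tensor_state A \<omega> \<and> (\<forall>a\<in>A. \<omega> (a \<otimes> 1) = \<mu> a) \<and>
        (\<forall>a'\<in>commutant A. \<omega> (1 \<otimes> a') = cinner (\<Lambda> \<nu>) (a' \<cdot> \<Lambda> \<nu>))}"

text \<open>By the Tomita--Takesaki theorem \<open>\<sigma>\<^sub>t\<^sup>\<nu>\<close> is a \<open>\<nu>\<close>-preserving automorphism of \<open>A\<close>, so it has a
  dual; being unique, the \<open>\<beta>'\<close> below is \<open>(\<sigma>\<^sub>t\<^sup>\<nu>)'\<close>.\<close>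

definition modular_transport_plans ::
    "'a::chilbert_space cop set \<Rightarrow> (('a cop \<Rightarrow> complex) \<Rightarrow> 'a) \<Rightarrow>
     ('a cop \<Rightarrow> complex) \<Rightarrow> ('a cop \<Rightarrow> complex) \<Rightarrow> (('a cop, 'a cop) tensor \<Rightarrow> complex) set" where
  "modular_transport_plans A \<Lambda> \<mu> \<nu> =
     {\<omega> \<in> transport_plans A \<Lambda> \<mu> \<nu>.
        \<forall>t \<beta>'. is_dual A (\<Lambda> \<nu>) (modular_group A (\<Lambda> \<nu>) t) \<beta>' \<longrightarrow>
          (\<forall>a\<in>A. \<forall>b'\<in>commutant A.
             \<omega> (modular_group A (\<Lambda> \<mu>) t a \<otimes> b') = \<omega> (a \<otimes> \<beta>' b'))}"

section \<open>Cyclic representations, cost and Wasserstein distance\<close>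

text \<open>Since the Hilbert space of a cyclic representation depends on the state, it cannot be a type.
  We use linear subspaces \<open>H\<close> of a complex vector space that are Hilbert spaces for an inner
  product \<open>ip\<close>.\<close>

definition hdist :: "('h::complex_vector \<Rightarrow> 'h \<Rightarrow> complex) \<Rightarrow> 'h \<Rightarrow> 'h \<Rightarrow> real" where
  "hdist ip x y = sqrt (Re (ip (x - y) (x - y)))"

definition hilbert_on :: "'h::complex_vector set \<Rightarrow> ('h \<Rightarrow> 'h \<Rightarrow> complex) \<Rightarrow> bool" where
  "hilbert_on H ip \<longleftrightarrow>
     csubspace H \<and>
     (\<forall>x\<in>H. clinear_on H (ip x)) \<and>
     (\<forall>x\<in>H. \<forall>y\<in>H. ip x y = cnj (ip y x)) \<and>
     (\<forall>x\<in>H. ip x x \<in> \<real>\<^sub>\<ge>\<^sub>0 \<and> (ip x x = 0 \<longrightarrow> x = 0)) \<and>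
     (\<forall>X. range X \<subseteq> H \<and> (\<forall>e>0. \<exists>N. \<forall>i\<ge>N. \<forall>j\<ge>N. hdist ip (X i) (X j) < e)
        \<longrightarrow> (\<exists>x\<in>H. (\<lambda>i::nat. hdist ip (X i) x) \<longlonglongrightarrow> 0))"

definition hclosure ::
    "'h::complex_vector set \<Rightarrow> ('h \<Rightarrow> 'h \<Rightarrow> complex) \<Rightarrow> 'h set \<Rightarrow> 'h set" where
  "hclosure H ip S = {x\<in>H. \<forall>e>0. \<exists>y\<in>S. hdist ip x y < e}"

definition cyclic_representation ::
    "'a::chilbert_space cop set \<Rightarrow> (('a cop, 'a cop) tensor \<Rightarrow> complex) \<Rightarrow>
     'h::complex_vector set \<Rightarrow> ('h \<Rightarrow> 'h \<Rightarrow> complex) \<Rightarrow>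
     (('a cop, 'a cop) tensor \<Rightarrow> 'h \<Rightarrow> 'h) \<Rightarrow> 'h \<Rightarrow> bool" where
  "cyclic_representation A \<omega> H ip \<pi> \<Omega> \<longleftrightarrow>
     hilbert_on H ip \<and> \<Omega> \<in> H \<and>
     (let T = alg_tensor A (commutant A) in
       (\<forall>t\<in>T. \<pi> t ` H \<subseteq> H \<and> clinear_on H (\<pi> t) \<and>
          (\<exists>K. \<forall>x\<in>H. hdist ip (\<pi> t x) 0 \<le> K * hdist ip x 0)) \<and>
       (\<forall>x\<in>H. clinear_on T (\<lambda>t. \<pi> t x)) \<and>
       (\<forall>s\<in>T. \<forall>t\<in>T. \<forall>x\<in>H. \<pi> (tmult s t) x = \<pi> s (\<pi> t x)) \<and>
       (\<forall>t\<in>T. \<forall>x\<in>H. \<forall>y\<in>H. ip (\<pi> t x) y = ip x (\<pi> (tstar t) y)) \<and>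
       (\<forall>x\<in>H. \<pi> (1 \<otimes> 1) x = x) \<and>
       hclosure H ip ((\<lambda>t. \<pi> t \<Omega>) ` T) = H \<and>
       (\<forall>t\<in>T. \<omega> t = ip \<Omega> (\<pi> t \<Omega>)))"

text \<open>\<open>source_rep\<close> is \<open>\<pi>\<^sub>\<mu>\<^sup>\<omega>\<close>, \<open>target_unitary\<close> is \<open>u\<^sub>\<nu>\<close> and \<open>target_rep\<close> is \<open>\<pi>\<^sub>\<nu>\<^sup>\<omega>\<close>, where \<open>v\<close> stands
  for \<open>\<Lambda>\<^sub>\<nu>\<close>. The adjoint of the unitary \<open>u\<^sub>\<nu>\<close> is its inverse.\<close>

definition source_rep ::
    "'a::chilbert_space cop set \<Rightarrow> 'h::complex_vector set \<Rightarrow> ('h \<Rightarrow> 'h \<Rightarrow> complex) \<Rightarrow>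
     (('a cop, 'a cop) tensor \<Rightarrow> 'h \<Rightarrow> 'h) \<Rightarrow> 'h \<Rightarrow> 'a cop \<Rightarrow> 'h \<Rightarrow> 'h" where
  "source_rep A H ip \<pi> \<Omega> a =
     restrict (\<pi> (a \<otimes> 1)) (hclosure H ip ((\<lambda>b. \<pi> (b \<otimes> 1) \<Omega>) ` A))"

definition target_unitary ::
    "'a::chilbert_space cop set \<Rightarrow> 'a \<Rightarrow> 'h::complex_vector set \<Rightarrow> ('h \<Rightarrow> 'h \<Rightarrow> complex) \<Rightarrow>
     (('a cop, 'a cop) tensor \<Rightarrow> 'h \<Rightarrow> 'h) \<Rightarrow> 'h \<Rightarrow> 'a \<Rightarrow> 'h" where
  "target_unitary A v H ip \<pi> \<Omega> =
     (THE u. clinear_on UNIV u \<and> (\<forall>x y. ip (u x) (u y) = cinner x y) \<and>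
        range u = hclosure H ip ((\<lambda>a'. \<pi> (1 \<otimes> a') \<Omega>) ` commutant A) \<and>
        (\<forall>a'\<in>commutant A. u (a' \<cdot> v) = \<pi> (1 \<otimes> a') \<Omega>))"

definition target_rep ::
    "'a::chilbert_space cop set \<Rightarrow> 'a \<Rightarrow> 'h::complex_vector set \<Rightarrow> ('h \<Rightarrow> 'h \<Rightarrow> complex) \<Rightarrow>
     (('a cop, 'a cop) tensor \<Rightarrow> 'h \<Rightarrow> 'h) \<Rightarrow> 'h \<Rightarrow> 'a cop \<Rightarrow> 'h \<Rightarrow> 'h" where
  "target_rep A v H ip \<pi> \<Omega> b =
     (let u = target_unitary A v H ip \<pi> \<Omega> in (\<lambda>x. u (b \<cdot> inv u x)))"

text \<open>The cost does not depend on the cyclic representation. Every cyclic representation is unitarily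
  equivalent to one on a space of complex functions on tensors, via
  \<open>\<xi> \<mapsto> (t \<mapsto> \<langle>\<pi>(t) \<Omega>, \<xi>\<rangle>)\<close> extended by \<open>0\<close>, so we choose one of this kind.\<close>

definition cost ::
    "'a::chilbert_space cop set \<Rightarrow> 'a \<Rightarrow> nat \<Rightarrow> (nat \<Rightarrow> 'a cop) \<Rightarrow>
     (('a cop, 'a cop) tensor \<Rightarrow> complex) \<Rightarrow> real" where
  "cost A v n k \<omega> =
     (case SOME (H :: (('a cop, 'a cop) tensor \<Rightarrow> complex) set, ip, \<pi>, \<Omega>).
         cyclic_representation A \<omega> H ip \<pi> \<Omega>
      of (H, ip, \<pi>, \<Omega>) \<Rightarrow>
        (\<Sum>l = 1..n. (hdist ip (source_rep A H ip \<pi> \<Omega> (k l) \<Omega>) (target_rep A v H ip \<pi> \<Omega> (k l) \<Omega>))\<^sup>2))"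

definition W2 ::
    "'a::chilbert_space cop set \<Rightarrow> (('a cop \<Rightarrow> complex) \<Rightarrow> 'a) \<Rightarrow> nat \<Rightarrow> (nat \<Rightarrow> 'a cop) \<Rightarrow>
     ('a cop \<Rightarrow> complex) \<Rightarrow> ('a cop \<Rightarrow> complex) \<Rightarrow> real" where
  "W2 A \<Lambda> n k \<mu> \<nu> = (INF \<omega>\<in>modular_transport_plans A \<Lambda> \<mu> \<nu>. sqrt (cost A (\<Lambda> \<nu>) n k \<omega>))"

end

(* The infimum is attained at the diagonal plan a \<otimes> a' \<mapsto> \<langle>\<Lambda>, a a' \<Lambda>\<rangle>: for it the modularity condition is
   literally the defining equation of the dual of the modular group, so no Tomita--Takesaki theory
   is needed. By uniqueness of the GNS construction, any cyclic representation of the diagonal plan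
   is unitarily equivalent to the representation of A \<odot> A' by multiplication on the Hilbert space
   with cyclic vector \<Lambda>. There the unitary of the target state is the identity, since \<Lambda>, being
   separating for A, is cyclic for A'. So both representations send k to k \<Lambda>, and the cost is 0. *)

theory Submission
  imports Defs
begin

section \<open>Orthogonal projections and adjoints\<close>

text \<open>\<open>adj\<close>, the target unitary and the multiplication map are definite
  descriptions, so each yields information only after existence and uniqueness are proved; adjoints
  thus rest on Riesz representation and closest points in closed subspaces. \<open>cost\<close>
  picks a cyclic representation by choice among those on spaces of functions on tensors. Hence one
  of that kind has to be constructed, so that the pick is a genuine cyclic representation, and the
  cost has to be computed in an arbitrary one. The passage from separating for A to cyclic for A' is
  a bicommutant argument with an orthogonal projection. Positivity of the plan comes from
  commutation of A and A': it makes a \<otimes> b \<mapsto> a b an involution-preserving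
  homomorphism, and the plan is a vector state composed with it.\<close>

lemma parallelogram_law:
  fixes x y :: "'a::real_inner"
  shows "(norm (x + y))\<^sup>2 + (norm (x - y))\<^sup>2 = 2 * (norm x)\<^sup>2 + 2 * (norm y)\<^sup>2"
  by (simp add: power2_norm_eq_inner inner_add inner_diff inner_commute)

text \<open>A minimising sequence for the distance to S is Cauchy by the parallelogram law, and its
  limit y is a closest point; if x - y were not orthogonal to some s, moving y along s would come
  closer. The real setting serves both Riesz representation and the complex projections.\<close>

lemma orthogonal_decomposition:
  fixes S :: "'a::{real_inner, complete_space} set"
  assumes "subspace S" "closed S"
  obtains y where "y \<in> S" "\<And>s. s \<in> S \<Longrightarrow> inner (x - y) s = 0"
proof -
  define d where "d = infdist x S"
  have S: "S \<noteq> {}" using assms(1) subspace_0 by auto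
  have d: "d \<le> norm (x - s)" if "s \<in> S" for s
    using that infdist_le[of s S x] by (simp add: d_def dist_norm)
  have d0: "d \<ge> 0" by (simp add: d_def infdist_nonneg)
  have "\<exists>s\<in>S. norm (x - s) < d + 1 / Suc n" for n
  proof -
    have "(INF s\<in>S. dist x s) < d + 1 / Suc n"
      using S by (simp add: d_def infdist_notempty)
    then show ?thesis
      using S by (subst (asm) cINF_less_iff) (auto simp: dist_norm intro!: bdd_belowI[of _ 0])
  qed
  then obtain Y where Y: "\<And>n. Y n \<in> S" "\<And>n. norm (x - Y n) < d + 1 / Suc n"
    by metis
  have lim: "(\<lambda>n. norm (x - Y n)) \<longlonglongrightarrow> d"
  proof (rule real_tendsto_sandwich[where f = "\<lambda>_. d" and h = "\<lambda>n. d + 1 / Suc n"])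
    show "(\<lambda>n. d + 1 / Suc n) \<longlonglongrightarrow> d"
      using tendsto_add[OF tendsto_const LIMSEQ_inverse_real_of_nat, of d]
      by (simp add: inverse_eq_divide)
  qed (use d Y in \<open>auto intro!: always_eventually less_imp_le simp: add.commute\<close>)
  \<comment> \<open>The midpoint of \<open>Y m\<close> and \<open>Y n\<close> lies in S, so its
    distance to x is at least d; the parallelogram law turns this into a bound on the
    difference.\<close>
  have est: "(norm (Y m - Y n))\<^sup>2 \<le> 2 * (norm (x - Y m))\<^sup>2 + 2 * (norm (x - Y n))\<^sup>2 - 4 * d\<^sup>2"
    for m n
  proof -
    have "(1/2) *\<^sub>R (Y m + Y n) \<in> S"
      using assms(1) Y(1) by (simp add: subspace_add subspace_scale)
    then have "d \<le> norm (x - (1/2) *\<^sub>R (Y m + Y n))" by (rule d)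
    also have "x - (1/2) *\<^sub>R (Y m + Y n) = (1/2) *\<^sub>R ((x - Y m) + (x - Y n))"
      by (simp add: algebra_simps flip: scaleR_2)
    finally have "2 * d \<le> norm ((x - Y m) + (x - Y n))" by simp
    then have "(2 * d)\<^sup>2 \<le> (norm ((x - Y m) + (x - Y n)))\<^sup>2"
      using d0 by (intro power_mono) auto
    then show ?thesis
      using parallelogram_law[of "x - Y m" "x - Y n"] norm_minus_commute[of "Y m" "Y n"]
      by (simp add: power2_eq_square)
  qed
  have "Cauchy Y"
  proof (rule metric_CauchyI)
    fix e :: real assume e: "e > 0"
    have "(\<lambda>n. (norm (x - Y n))\<^sup>2) \<longlonglongrightarrow> d\<^sup>2" by (intro tendsto_intros lim)
    \<comment> \<open>With e^2/4 at both indices, \<open>est\<close> gives 2 (d^2 + e^2/4) + 2 (d^2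
      + e^2/4) - 4 d^2 = e^2.\<close>
    then have "\<forall>\<^sub>F n in sequentially. (norm (x - Y n))\<^sup>2 < d\<^sup>2 + e\<^sup>2 / 4"
      by (rule order_tendstoD) (use e in auto)
    then obtain N where N: "\<And>n. n \<ge> N \<Longrightarrow> (norm (x - Y n))\<^sup>2 < d\<^sup>2 + e\<^sup>2 / 4"
      by (auto simp: eventually_sequentially)
    have "dist (Y m) (Y n) < e" if "m \<ge> N" "n \<ge> N" for m n
    proof -
      have "(norm (Y m - Y n))\<^sup>2 < e\<^sup>2" using est[of m n] N[OF that(1)] N[OF that(2)] by linarith
      then show ?thesis using e by (simp add: dist_norm power_less_imp_less_base)
    qed
    then show "\<exists>N. \<forall>m\<ge>N. \<forall>n\<ge>N. dist (Y m) (Y n) < e" by blast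
  qed
  then obtain y where y: "Y \<longlonglongrightarrow> y" using Cauchy_convergent convergent_def by blast
  have yS: "y \<in> S" using closed_sequentially[OF assms(2) _ y] Y(1) by blast
  have "(\<lambda>n. norm (x - Y n)) \<longlonglongrightarrow> norm (x - y)" by (intro tendsto_intros y)
  with lim have nd: "norm (x - y) = d" using LIMSEQ_unique by blast
  have "inner (x - y) s = 0" if s: "s \<in> S" for s
  proof (rule ccontr)
    assume ne: "inner (x - y) s \<noteq> 0"
    \<comment> \<open>The minimiser of the quadratic r \<mapsto> |x - y - r s|^2, whose minimum is
      below d^2 when the inner product is nonzero.\<close>
    define r where "r = inner (x - y) s / inner s s"
    have s0: "inner s s > 0" using ne by auto
    have "y + r *\<^sub>R s \<in> S" using assms(1) yS s by (simp add: subspace_add subspace_scale)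
    then have "d\<^sup>2 \<le> (norm (x - (y + r *\<^sub>R s)))\<^sup>2" using d d0 by (intro power_mono) auto
    also have "x - (y + r *\<^sub>R s) = (x - y) - r *\<^sub>R s" by simp
    also have "(norm ((x - y) - r *\<^sub>R s))\<^sup>2 = (norm (x - y))\<^sup>2 - 2 * r * inner (x - y) s + r\<^sup>2 * inner s s"
      unfolding power2_norm_eq_inner
      by (simp only: inner_diff_left[of "x - y" "r *\<^sub>R s"] inner_diff_right[of _ "x - y" "r *\<^sub>R s"]
         inner_scaleR_left inner_scaleR_right inner_commute[of s "x - y"] power2_eq_square)
        (simp add: algebra_simps)
    also have "\<dots> = d\<^sup>2 - (inner (x - y) s)\<^sup>2 / inner s s"
      using s0 by (simp add: r_def nd power2_eq_square)
    finally show False using ne s0 by (simp add: divide_le_0_iff)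
  qed
  with yS that show ?thesis by blast
qed

lemma riesz_representation:
  fixes f :: "'a::{real_inner, complete_space} \<Rightarrow> real"
  assumes "bounded_linear f"
  obtains z where "\<And>x. f x = inner z x"
proof (cases "\<forall>x. f x = 0")
  case True
  then show ?thesis using that[of 0] by simp
next
  case False
  then obtain w where w: "f w \<noteq> 0" by blast
  interpret bounded_linear f by fact
  have "subspace {x. f x = 0}" by (auto simp: subspace_def zero add scaleR)
  moreover have "closed {x. f x = 0}"
    by (intro closed_Collect_eq continuous_intros linear_continuous_on assms)
  ultimately obtain y where y: "f y = 0" "\<And>s. f s = 0 \<Longrightarrow> inner (w - y) s = 0"
    using orthogonal_decomposition[of "{x. f x = 0}" w] by auto
  define e where "e = w - y"
  have e: "f e = f w" "e \<noteq> 0" using y(1) w by (auto simp: e_def diff)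
  have "f x = inner ((f e / inner e e) *\<^sub>R e) x" for x
  proof -
    \<comment> \<open>The vector \<open>f e *\<^sub>R x - f x *\<^sub>R e\<close> lies in the kernel
      of f, to which e is orthogonal.\<close>
    have "inner e (f e *\<^sub>R x - f x *\<^sub>R e) = 0"
      unfolding e_def by (rule y(2)) (simp add: diff scaleR)
    then show ?thesis using e by (simp add: inner_diff_right field_simps)
  qed
  then show ?thesis by (rule that)
qed

section \<open>Calculus of the complex inner product and of bounded operators\<close>

lemma cinner_add_left: "cinner (x + y) z = cinner x z + cinner y z"
  by (metis cinner_add_right cinner_commute complex_cnj_add)

lemma cinner_scaleC_left: "cinner (c *\<^sub>C x) y = cnj c * cinner x y"
  by (metis cinner_commute cinner_scaleC_right complex_cnj_mult)

lemma cinner_zero_right [simp]: "cinner x 0 = 0"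
  using cinner_add_right[of x 0 0] by simp

lemma cinner_zero_left [simp]: "cinner 0 x = 0"
  using cinner_add_left[of 0 0 x] by simp

lemma cinner_minus_right: "cinner x (- y) = - cinner x y"
  using cinner_add_right[of x y "- y"] by (simp add: eq_neg_iff_add_eq_0 add.commute)

lemma cinner_minus_left: "cinner (- x) y = - cinner x y"
  using cinner_add_left[of x "- x" y] by (simp add: eq_neg_iff_add_eq_0 add.commute)

lemma cinner_diff_right: "cinner x (y - z) = cinner x y - cinner x z"
  using cinner_add_right[of x y "- z"] by (simp add: cinner_minus_right)

lemma cinner_diff_left: "cinner (x - y) z = cinner x z - cinner y z"
  using cinner_add_left[of x "- y" z] by (simp add: cinner_minus_left)

lemma cinner_sum_right: "cinner x (\<Sum>i\<in>I. f i) = (\<Sum>i\<in>I. cinner x (f i))"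
  by (induction I rule: infinite_finite_induct) (auto simp: cinner_add_right)

lemma Im_cinner: "Im (cinner x y) = - inner x (\<i> *\<^sub>C y)"
  by (simp add: inner_eq_Re_cinner cinner_scaleC_right)

text \<open>The imaginary part is recovered by testing with \<i> y, so existence, orthogonality and
  continuity results for \<open>inner\<close> carry over to \<open>cinner\<close>.\<close>

lemma cinner_eq_inner: "cinner x y = Complex (inner x y) (- inner x (\<i> *\<^sub>C y))"
  by (simp add: complex_eq_iff Im_cinner inner_eq_Re_cinner)

lemma cinner_self: "cinner x x = complex_of_real ((norm x)\<^sup>2)"
proof -
  have "Im (cinner x x) = 0" by (metis cinner_commute cnj.simps(2) equal_neg_zero)
  then show ?thesis by (simp add: complex_eq_iff power2_norm_eq_inner inner_eq_Re_cinner)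
qed

lemma cinner_eqI:
  assumes "\<And>x. cinner x y = cinner x z"
  shows "y = z"
proof -
  have "cinner (y - z) (y - z) = 0" using assms[of "y - z"] by (simp add: cinner_diff_right)
  then show ?thesis by (simp add: cinner_self)
qed

lemma tendsto_cinner [tendsto_intros]:
  assumes "(f \<longlongrightarrow> x) F" "(g \<longlongrightarrow> y) F"
  shows "((\<lambda>n. cinner (f n) (g n)) \<longlongrightarrow> cinner x y) F"
  unfolding cinner_eq_inner
  by (intro tendsto_intros assms bounded_linear.tendsto[OF bounded_linear_scaleC])

lemma bounded_linear_cop: "bounded_linear (cop_apply a)"
  using cop_apply[of a] by simp

lemma cop_scaleC: "a \<cdot> (c *\<^sub>C x) = c *\<^sub>C (a \<cdot> x)"
  using cop_apply[of a] by simp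

lemma cop_add: "a \<cdot> (x + y) = a \<cdot> x + a \<cdot> y"
  by (rule linear_add) (rule bounded_linear.linear[OF bounded_linear_cop])

lemma cop_mult_scaleC_right: "a * (c *\<^sub>C b) = c *\<^sub>C (a * b)" for a :: "'a::chilbert_space cop"
  by (rule cop_eqI) (simp add: times_cop.rep_eq scaleC_cop.rep_eq cop_scaleC)

lemma cop_mult_scaleC_left: "(c *\<^sub>C a) * b = c *\<^sub>C (a * b)" for a :: "'a::chilbert_space cop"
  by (rule cop_eqI) (simp add: times_cop.rep_eq scaleC_cop.rep_eq)

lemma cop_sum_left: "(\<Sum>i\<in>I. a i) \<cdot> x = (\<Sum>i\<in>I. a i \<cdot> x)"
  by (induction I rule: infinite_finite_induct) (auto simp: zero_cop.rep_eq plus_cop.rep_eq)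

section \<open>Existence and algebra of adjoints\<close>

lemma cop_eq_cinnerI:
  assumes "\<And>x y. cinner x (a \<cdot> y) = cinner x (b \<cdot> y)"
  shows "a = b"
  by (rule cop_eqI) (rule cinner_eqI, rule assms)

text \<open>Riesz is applied to the real functional x \<mapsto> inner y (a x); complex linearity of
  a then upgrades the identity from \<open>inner\<close> to \<open>cinner\<close>, and linearity and
  boundedness of g follow from the identities.\<close>

lemma ex_adjoint: "\<exists>b :: 'a::chilbert_space cop. \<forall>x y. cinner (a \<cdot> x) y = cinner x (b \<cdot> y)"
proof -
  obtain K where K: "K > 0" "\<And>x. norm (a \<cdot> x) \<le> norm x * K"
    using bounded_linear.pos_bounded[OF bounded_linear_cop] by blast
  have "\<exists>z. \<forall>x. inner y (a \<cdot> x) = inner z x" for y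
    using riesz_representation[of "\<lambda>x. inner y (a \<cdot> x)"]
      bounded_linear_compose[OF bounded_linear_inner_right bounded_linear_cop] by metis
  then obtain g where g: "\<And>x y. inner y (a \<cdot> x) = inner (g y) x" by metis
  have h: "cinner y (a \<cdot> x) = cinner (g y) x" for x y
    by (simp add: cinner_eq_inner flip: cop_scaleC g)
  have G: "cinner (a \<cdot> x) y = cinner x (g y)" for x y
    using h[of y x] cinner_commute[of "a \<cdot> x" y] cinner_commute[of x "g y"] by simp
  have add: "g (x + y) = g x + g y" for x y
    by (rule cinner_eqI) (simp add: cinner_add_right flip: G)
  have scale: "g (c *\<^sub>C x) = c *\<^sub>C g x" for c x
    by (rule cinner_eqI) (simp add: cinner_scaleC_right flip: G)
  have bound: "norm (g x) \<le> norm x * K" for x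
  proof (cases "g x = 0")
    case False
    have "norm (g x) * norm (g x) = inner x (a \<cdot> g x)"
      by (simp add: g flip: power2_norm_eq_inner power2_eq_square)
    also have "\<dots> \<le> norm x * norm (a \<cdot> g x)" by (rule norm_cauchy_schwarz)
    also have "\<dots> \<le> norm x * (norm (g x) * K)" by (intro mult_left_mono K) auto
    finally show ?thesis using False by (simp add: mult.assoc mult.left_commute)
  qed (use K in simp)
  have "bounded_linear g"
    by (rule bounded_linear_intro[OF add _ bound]) (simp add: scaleR_scaleC scale)
  then have "cop_apply (Cop g) = g" using scale by (intro Cop_inverse) simp
  with G show ?thesis by metis
qed

lemma cinner_adj_right: "cinner x (adj a \<cdot> y) = cinner (a \<cdot> x) y"
proof -
  obtain b where b: "\<forall>x y. cinner (a \<cdot> x) y = cinner x (b \<cdot> y)" using ex_adjoint by blast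
  have "adj a = b" unfolding adj_def
  proof (rule the_equality)
    show "c = b" if "\<forall>x y. cinner (a \<cdot> x) y = cinner x (c \<cdot> y)" for c
      using that b by (intro cop_eq_cinnerI) simp
  qed (rule b)
  then show ?thesis using b by simp
qed

lemma cinner_adj_left: "cinner (adj a \<cdot> x) y = cinner x (a \<cdot> y)"
  using cinner_adj_right[of y a x] cinner_commute[of "adj a \<cdot> x" y] cinner_commute[of x "a \<cdot> y"]
  by simp

lemma adj_adj: "adj (adj a) = a"
  by (rule cop_eq_cinnerI) (simp add: cinner_adj_right cinner_adj_left)

lemma adj_add: "adj (a + b) = adj a + adj b"
  by (rule cop_eq_cinnerI)
    (simp add: cinner_adj_right plus_cop.rep_eq cinner_add_right cinner_add_left)

lemma adj_scaleC: "adj (c *\<^sub>C a) = cnj c *\<^sub>C adj a"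
  by (rule cop_eq_cinnerI)
    (simp add: cinner_adj_right scaleC_cop.rep_eq cinner_scaleC_right cinner_scaleC_left)

lemma adj_mult: "adj (a * b) = adj b * adj a"
  by (rule cop_eq_cinnerI) (simp add: cinner_adj_right times_cop.rep_eq)

lemma adj_zero: "adj 0 = 0"
  by (rule cop_eq_cinnerI) (simp add: cinner_adj_right zero_cop.rep_eq)

section \<open>Commutants, orthogonal projections and cyclic vectors\<close>

lemma commutant_adj:
  assumes "adj ` A \<subseteq> A" "b \<in> commutant A"
  shows "adj b \<in> commutant A"
  unfolding commutant_def
proof safe
  fix a assume "a \<in> A"
  then have "adj a * b = b * adj a" using assms by (auto simp: commutant_def)
  then have "adj (adj a * b) = adj (b * adj a)" by simp
  then show "a * adj b = adj b * a" by (simp add: adj_mult adj_adj)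
qed

lemma one_in_commutant: "1 \<in> commutant A"
  by (simp add: commutant_def)

lemma mult_in_commutant: "a \<in> commutant A \<Longrightarrow> b \<in> commutant A \<Longrightarrow> a * b \<in> commutant A"
  by (simp add: commutant_def) (metis mult.assoc)

lemma subspace_if_csubspace: "csubspace S \<Longrightarrow> subspace (S :: 'a::chilbert_space set)"
  by (simp add: subspace_def csubspace_def scaleR_scaleC)

text \<open>Since S is stable under multiplication by \<i>, real orthogonality to S is complex
  orthogonality. The last clause allows \<open>p \<cdot> x\<close> to be identified by exhibiting a
  vector of S with orthogonal residue.\<close>

lemma ex_projection:
  fixes S :: "'a::chilbert_space set"
  assumes "csubspace S" "closed S"
  shows "\<exists>p :: 'a cop. (\<forall>x. p \<cdot> x \<in> S) \<and> (\<forall>x. \<forall>s\<in>S. cinner (x - p \<cdot> x) s = 0) \<and>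
    (\<forall>x. \<forall>y\<in>S. (\<forall>s\<in>S. cinner (x - y) s = 0) \<longrightarrow> p \<cdot> x = y)"
proof -
  have S: "subspace S"
    using assms(1) by (rule subspace_if_csubspace)
  have "\<exists>y\<in>S. \<forall>s\<in>S. cinner (x - y) s = 0" for x
  proof -
    obtain y where "y \<in> S" "\<And>s. s \<in> S \<Longrightarrow> inner (x - y) s = 0"
      using orthogonal_decomposition[OF S assms(2)] by blast
    moreover from assms(1) have "\<i> *\<^sub>C s \<in> S" if "s \<in> S" for s
      using that by (simp add: csubspace_def)
    ultimately show ?thesis
      by (intro bexI[of _ y]) (auto simp: cinner_eq_inner complex_eq_iff)
  qed
  then obtain g where g: "\<And>x. g x \<in> S" "\<And>x s. s \<in> S \<Longrightarrow> cinner (x - g x) s = 0" by metis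
  have unique: "g x = y" if "y \<in> S" "\<And>s. s \<in> S \<Longrightarrow> cinner (x - y) s = 0" for x y
  proof -
    have "g x - y \<in> S" using g(1) that(1) S by (simp add: subspace_diff)
    then have "cinner (g x - y) (g x - y) = 0"
      using g(2)[of "g x - y" x] that(2)[of "g x - y"] by (simp add: cinner_diff_left)
    then show ?thesis by (simp add: cinner_self)
  qed
  have add: "g (x + y) = g x + g y" for x y
  proof (rule unique)
    show "g x + g y \<in> S" using g(1) S by (simp add: subspace_add)
    show "cinner (x + y - (g x + g y)) s = 0" if "s \<in> S" for s
      using g(2)[OF that, of x] g(2)[OF that, of y] by (simp add: cinner_diff_left cinner_add_left)
  qed
  have scale: "g (c *\<^sub>C x) = c *\<^sub>C g x" for c x
  proof (rule unique)
    show "c *\<^sub>C g x \<in> S" using g(1) assms(1) by (simp add: csubspace_def)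
    show "cinner (c *\<^sub>C x - c *\<^sub>C g x) s = 0" if "s \<in> S" for s
      using g(2)[OF that, of x] by (simp add: cinner_diff_left cinner_scaleC_left)
  qed
  have bound: "norm (g x) \<le> norm x * 1" for x
  proof -
    have "cinner (g x) (g x) = cinner x (g x)"
      using g(2)[OF g(1), of x x] by (simp add: cinner_diff_left)
    then have "norm (g x) * norm (g x) = inner x (g x)"
      by (metis inner_eq_Re_cinner power2_norm_eq_inner power2_eq_square)
    also have "\<dots> \<le> norm x * norm (g x)" by (rule norm_cauchy_schwarz)
    finally show ?thesis by (cases "g x = 0") auto
  qed
  have "bounded_linear g"
    by (rule bounded_linear_intro[OF add _ bound]) (simp add: scaleR_scaleC scale)
  then have "cop_apply (Cop g) = g" using scale by (intro Cop_inverse) simp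
  then show ?thesis using g unique by (intro exI[of _ "Cop g"]) auto
qed

lemma limit_in_closure:
  fixes x :: "'a::metric_space"
  shows "(\<And>n. X n \<in> S) \<Longrightarrow> X \<longlonglongrightarrow> x \<Longrightarrow> x \<in> closure S"
  by (auto simp: closure_sequential)

text \<open>The projection p onto the closure of A'v commutes with A', so 1 - p lies in A'' = A. It
  annihilates v, and v separates A, so p = 1.\<close>

lemma cyclic_vector_commutant:
  fixes A :: "'a::chilbert_space cop set"
  assumes "von_neumann_algebra A" "separating_vector A v"
  shows "cyclic_vector (commutant A) v"
proof -
  define S0 where "S0 = (\<lambda>b. b \<cdot> v) ` commutant A"
  define S where "S = closure S0"
  have A: "adj ` A \<subseteq> A" "commutant (commutant A) = A"
    using assms(1) by (auto simp: von_neumann_algebra_def)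
  have S0: "csubspace S0"
    unfolding csubspace_def
  proof (intro conjI ballI allI)
    show "0 \<in> S0" unfolding S0_def
      by (rule image_eqI[of _ _ 0]) (auto simp: zero_cop.rep_eq commutant_def)
    fix x c assume "x \<in> S0"
    then obtain a where a: "a \<in> commutant A" "x = a \<cdot> v" by (auto simp: S0_def)
    have "c *\<^sub>C a \<in> commutant A" using a(1)
      by (simp add: commutant_def cop_mult_scaleC_left cop_mult_scaleC_right)
    then show "c *\<^sub>C x \<in> S0" unfolding S0_def
      by (rule image_eqI[rotated]) (simp add: a scaleC_cop.rep_eq)
    fix y assume "y \<in> S0"
    then obtain b where b: "b \<in> commutant A" "y = b \<cdot> v" by (auto simp: S0_def)
    have "a + b \<in> commutant A" using a(1) b(1) by (auto simp: commutant_def algebra_simps)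
    then show "x + y \<in> S0" unfolding S0_def
      by (rule image_eqI[rotated]) (simp add: a(2) b(2) plus_cop.rep_eq)
  qed
  have S: "csubspace S"
    unfolding csubspace_def
  proof (intro conjI ballI allI)
    show "0 \<in> S" using S0 closure_subset by (auto simp: csubspace_def S_def)
    fix x c assume "x \<in> S"
    then obtain X where X: "\<And>n. X n \<in> S0" "X \<longlonglongrightarrow> x" by (auto simp: S_def closure_sequential)
    have "(\<lambda>n. c *\<^sub>C X n) \<longlonglongrightarrow> c *\<^sub>C x"
      by (rule bounded_linear.tendsto[OF bounded_linear_scaleC X(2)])
    moreover have "c *\<^sub>C X n \<in> S0" for n using S0 X by (simp add: csubspace_def)
    ultimately show "c *\<^sub>C x \<in> S" unfolding S_def by (rule limit_in_closure[rotated])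
    fix y assume "y \<in> S"
    then obtain Y where Y: "\<And>n. Y n \<in> S0" "Y \<longlonglongrightarrow> y" by (auto simp: S_def closure_sequential)
    have "X n + Y n \<in> S0" for n using S0 X Y by (simp add: csubspace_def)
    with tendsto_add[OF X(2) Y(2)] show "x + y \<in> S"
      unfolding S_def by (rule limit_in_closure[rotated])
  qed
  have inv: "b \<cdot> x \<in> S" if b: "b \<in> commutant A" and x: "x \<in> S" for b x
  proof -
    obtain X where X: "\<And>n. X n \<in> S0" "X \<longlonglongrightarrow> x"
      using x by (auto simp: S_def closure_sequential)
    have mem: "b \<cdot> X n \<in> S0" for n
    proof -
      obtain c where c: "c \<in> commutant A" "X n = c \<cdot> v" using X(1)[of n] by (auto simp: S0_def)
      show ?thesis unfolding S0_def
        by (rule image_eqI[of _ _ "b * c"]) (simp_all add: c times_cop.rep_eq mult_in_commutant[OF b])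
    qed
    have "(\<lambda>n. b \<cdot> X n) \<longlonglongrightarrow> b \<cdot> x"
      by (rule bounded_linear.tendsto[OF bounded_linear_cop X(2)])
    then show ?thesis unfolding S_def by (rule limit_in_closure[OF mem])
  qed
  have "closed S" by (simp add: S_def)
  from ex_projection[OF S this] obtain p :: "'a cop" where p: "\<forall>x. p \<cdot> x \<in> S"
    and orth: "\<forall>x. \<forall>s\<in>S. cinner (x - p \<cdot> x) s = 0"
    and unique: "\<forall>x. \<forall>y\<in>S. (\<forall>s\<in>S. cinner (x - y) s = 0) \<longrightarrow> p \<cdot> x = y"
    by blast
  \<comment> \<open>b maps S into itself and x - p x to a vector orthogonal to S, because
    \<open>adj b\<close> also preserves S; uniqueness gives p b x = b p x.\<close>
  have "b * p = p * b" if b: "b \<in> commutant A" for b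
  proof (rule cop_eqI, unfold times_cop.rep_eq, rule sym, rule unique[rule_format])
    fix x
    show "b \<cdot> p \<cdot> x \<in> S" using p by (intro inv[OF b]) simp
    fix s assume s: "s \<in> S"
    have "b \<cdot> x - b \<cdot> p \<cdot> x = b \<cdot> (x - p \<cdot> x)"
      by (rule linear_diff[symmetric]) (rule bounded_linear.linear[OF bounded_linear_cop])
    then have "cinner (b \<cdot> x - b \<cdot> p \<cdot> x) s = cinner (x - p \<cdot> x) (adj b \<cdot> s)"
      by (simp add: cinner_adj_right)
    also have "\<dots> = 0" by (intro orth[rule_format] inv commutant_adj[OF A(1) b] s)
    finally show "cinner (b \<cdot> x - b \<cdot> p \<cdot> x) s = 0" .
  qed
  then have "1 - p \<in> commutant (commutant A)"
    by (subst commutant_def) (simp add: left_diff_distrib right_diff_distrib)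
  then have "1 - p \<in> A" by (simp only: A(2))
  moreover have "v \<in> S" unfolding S_def S0_def
    by (rule subsetD[OF closure_subset]) (rule image_eqI[OF _ one_in_commutant], simp add: one_cop.rep_eq)
  then have "p \<cdot> v = v" using unique by auto
  then have "(1 - p) \<cdot> v = 0" by (simp add: minus_cop.rep_eq one_cop.rep_eq)
  ultimately have "1 - p = 0" using assms(2) by (auto simp: separating_vector_def)
  then have "p = 1" by simp
  then have "x \<in> S" for x using p[rule_format, of x] by (simp add: one_cop.rep_eq)
  then show ?thesis by (auto simp: cyclic_vector_def S_def S0_def)
qed

text \<open>The difference x - y is a limit of orbit vectors, all orthogonal to it, so it is
  orthogonal to itself. Injectivity of the embedding into functions and uniqueness of the target
  unitary are reduced to this.\<close>

lemma cyclic_vector_eqI: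
  assumes "cyclic_vector A v" "\<And>a. a \<in> A \<Longrightarrow> cinner (a \<cdot> v) x = cinner (a \<cdot> v) y"
  shows "x = y"
proof -
  have "x - y \<in> closure ((\<lambda>a. a \<cdot> v) ` A)" using assms(1) by (simp add: cyclic_vector_def)
  then obtain X where X: "\<And>n. X n \<in> (\<lambda>a. a \<cdot> v) ` A" "X \<longlonglongrightarrow> x - y"
    by (auto simp: closure_sequential)
  have "(\<lambda>n. cinner (X n) (x - y)) \<longlonglongrightarrow> cinner (x - y) (x - y)" by (intro tendsto_intros X)
  moreover have "cinner (X n) (x - y) = 0" for n
    using X(1)[of n] assms(2) by (auto simp: cinner_diff_right)
  ultimately have "(\<lambda>n. 0) \<longlonglongrightarrow> cinner (x - y) (x - y)" by simp
  then have "cinner (x - y) (x - y) = 0" by (rule LIMSEQ_unique[OF _ tendsto_const])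
  then show ?thesis by (simp add: cinner_self)
qed

section \<open>The multiplication map on the algebraic tensor product\<close>

lemma sum_fun_apply: "(\<Sum>i\<in>I. f i) x = (\<Sum>i\<in>I. f i x)"
  by (induction I rule: infinite_finite_induct) auto

text \<open>\<open>tens\<close> returns 0 at functions that are not bilinear, so this is what makes
  elementary tensors evaluate to matrix coefficients of a b.\<close>

lemma bilinear_form_cinner: "bilinear_form (\<lambda>a b. cinner x (a \<cdot> b \<cdot> y))"
  by (auto simp: bilinear_form_def clinear_on_def plus_cop.rep_eq scaleC_cop.rep_eq cop_add
      cop_scaleC cinner_add_right cinner_scaleC_right scaleC_complex_def)

lemma tens_in_alg_tensor: "a \<in> S \<Longrightarrow> b \<in> T \<Longrightarrow> a \<otimes> b \<in> alg_tensor S T"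
  unfolding alg_tensor_def by (auto intro!: exI[of _ "1::nat"] exI[of _ "\<lambda>_. a"] exI[of _ "\<lambda>_. b"])

lemma zero_in_alg_tensor: "0 \<in> alg_tensor S T"
  unfolding alg_tensor_def by (auto intro!: exI[of _ "0::nat"])

lemma add_in_alg_tensor:
  assumes "s \<in> alg_tensor S T" "t \<in> alg_tensor S T"
  shows "s + t \<in> alg_tensor S T"
proof -
  obtain m a b where s: "s = (\<Sum>i<m::nat. a i \<otimes> b i)" "\<forall>i<m. a i \<in> S \<and> b i \<in> T"
    using assms(1) by (auto simp: alg_tensor_def)
  obtain n c d where t: "t = (\<Sum>i<n::nat. c i \<otimes> d i)" "\<forall>i<n. c i \<in> S \<and> d i \<in> T"
    using assms(2) by (auto simp: alg_tensor_def)
  \<comment> \<open>The two families are concatenated, the second one starting at index m.\<close>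
  define e where "e i = (if i < m then a i else c (i - m))" for i
  define f where "f i = (if i < m then b i else d (i - m))" for i
  have "(\<Sum>i<m + n. e i \<otimes> f i) = (\<Sum>i<m. e i \<otimes> f i) + (\<Sum>i=m..<m + n. e i \<otimes> f i)"
    by (simp add: lessThan_atLeast0 sum.atLeastLessThan_concat)
  also have "(\<Sum>i=m..<m + n. e i \<otimes> f i) = (\<Sum>i<n. e (i + m) \<otimes> f (i + m))"
    using sum.shift_bounds_nat_ivl[of "\<lambda>i. e i \<otimes> f i" 0 m n]
    by (simp add: lessThan_atLeast0 add.commute)
  also have "(\<Sum>i<m. e i \<otimes> f i) + \<dots> = s + t"
    by (simp add: s t e_def f_def)
  finally have "(\<Sum>i<m + n. e i \<otimes> f i) = s + t" .
  moreover have "\<forall>i<m + n. e i \<in> S \<and> f i \<in> T" using s t by (auto simp: e_def f_def)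
  ultimately show ?thesis unfolding alg_tensor_def
    by (intro CollectI exI[of _ "m + n"] exI[of _ e] exI[of _ f]) simp
qed

lemma sum_in_alg_tensor:
  "(\<And>i. i \<in> I \<Longrightarrow> f i \<in> alg_tensor S T) \<Longrightarrow> (\<Sum>i\<in>I. f i) \<in> alg_tensor S T"
  by (induction I rule: infinite_finite_induct) (auto intro: add_in_alg_tensor zero_in_alg_tensor)

lemma alg_tensorE:
  assumes "t \<in> alg_tensor S T"
  obtains m :: nat and a b
  where "t = (\<Sum>i<m. a i \<otimes> b i)" "\<And>i. i < m \<Longrightarrow> a i \<in> S" "\<And>i. i < m \<Longrightarrow> b i \<in> T"
  using assms by (auto simp: alg_tensor_def)

lemma tmult_sum:
  "tmult (\<Sum>i\<in>I. a i \<otimes> b i) (\<Sum>j\<in>J. c j \<otimes> d j) = (\<Sum>i\<in>I. \<Sum>j\<in>J. (a i * c j) \<otimes> (b i * d j))"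
proof
  fix B
  show "tmult (\<Sum>i\<in>I. a i \<otimes> b i) (\<Sum>j\<in>J. c j \<otimes> d j) B
      = (\<Sum>i\<in>I. \<Sum>j\<in>J. (a i * c j) \<otimes> (b i * d j)) B"
  proof (cases "bilinear_form B")
    case True
    have R: "bilinear_form (\<lambda>c d. B (a * c) (b * d))" for a b
      using True by (simp add: bilinear_form_def clinear_on_def cop_mult_scaleC_right distrib_left)
    \<comment> \<open>Evaluating the right factor leaves this sum as a function of the left pair; it
      has to be bilinear, or the left \<open>tens\<close> would return 0.\<close>
    have "bilinear_form (\<lambda>a b. \<Sum>j\<in>J. B (a * c j) (b * d j))"
      using True by (simp add: bilinear_form_def clinear_on_def cop_mult_scaleC_left distrib_right
          sum.distrib scaleC_complex_def sum_distrib_left)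
    with True R show ?thesis by (simp add: tmult_def tens_def sum_fun_apply)
  qed (simp add: tmult_def tens_def sum_fun_apply)
qed

lemma tstar_sum: "tstar (\<Sum>i\<in>I. a i \<otimes> b i) = (\<Sum>i\<in>I. adj (a i) \<otimes> adj (b i))"
proof
  fix B
  show "tstar (\<Sum>i\<in>I. a i \<otimes> b i) B = (\<Sum>i\<in>I. adj (a i) \<otimes> adj (b i)) B"
  proof (cases "bilinear_form B")
    case True
    then have "bilinear_form (\<lambda>a b. cnj (B (adj a) (adj b)))"
      by (simp add: bilinear_form_def clinear_on_def adj_add adj_scaleC scaleC_complex_def)
    with True show ?thesis by (simp add: tstar_def tens_def sum_fun_apply)
  qed (simp add: tstar_def tens_def sum_fun_apply)
qed

lemma tmult_in_alg_tensor:
  assumes "s \<in> alg_tensor S T" "t \<in> alg_tensor S T"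
    and "\<And>a b. a \<in> S \<Longrightarrow> b \<in> S \<Longrightarrow> a * b \<in> S" "\<And>a b. a \<in> T \<Longrightarrow> b \<in> T \<Longrightarrow> a * b \<in> T"
  shows "tmult s t \<in> alg_tensor S T"
  by (rule alg_tensorE[OF assms(1)], rule alg_tensorE[OF assms(2)])
    (auto simp: tmult_sum intro!: sum_in_alg_tensor tens_in_alg_tensor assms(3,4))

lemma tstar_in_alg_tensor:
  assumes "t \<in> alg_tensor S T" "\<And>a. a \<in> S \<Longrightarrow> adj a \<in> S" "\<And>a. a \<in> T \<Longrightarrow> adj a \<in> T"
  shows "tstar t \<in> alg_tensor S T"
  by (rule alg_tensorE[OF assms(1)])
    (auto simp: tstar_sum intro!: sum_in_alg_tensor tens_in_alg_tensor assms(2,3))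

text \<open>The linear extension of a \<otimes> b \<mapsto> a b. A tensor is a functional on
  bilinear forms, so its values at (a, b) \<mapsto> \<langle>x, a b y\<rangle> are the matrix
  coefficients of the product operator; independence of the chosen sum of elementary tensors is
  built in.\<close>

definition mult_tensor :: "('a::chilbert_space cop, 'a cop) tensor \<Rightarrow> 'a cop" where
  "mult_tensor t = (THE c. \<forall>x y. cinner x (c \<cdot> y) = t (\<lambda>a b. cinner x (a \<cdot> b \<cdot> y)))"

lemma mult_tensor_eqI:
  assumes "\<And>x y. t (\<lambda>a b. cinner x (a \<cdot> b \<cdot> y)) = cinner x (c \<cdot> y)"
  shows "mult_tensor t = c"
  unfolding mult_tensor_def
proof (rule the_equality)
  show "d = c" if "\<forall>x y. cinner x (d \<cdot> y) = t (\<lambda>a b. cinner x (a \<cdot> b \<cdot> y))" for d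
    using that assms by (intro cop_eq_cinnerI) simp
qed (simp add: assms)

lemma mult_tensor_sum: "mult_tensor (\<Sum>i\<in>I. a i \<otimes> b i) = (\<Sum>i\<in>I. a i * b i)"
  by (rule mult_tensor_eqI) (simp add: sum_fun_apply tens_def bilinear_form_cinner cop_sum_left
      cinner_sum_right times_cop.rep_eq)

lemma mult_tensor_tens: "mult_tensor (a \<otimes> b) = a * b"
  using mult_tensor_sum[of "\<lambda>_. a" "\<lambda>_. b" "{()}"] by simp

text \<open>For sums of elementary tensors the described operator exists, namely the sum of the
  products, so the definite description has its defining property.\<close>

lemma cinner_mult_tensor:
  assumes "t \<in> alg_tensor S T"
  shows "t (\<lambda>a b. cinner x (a \<cdot> b \<cdot> y)) = cinner x (mult_tensor t \<cdot> y)"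
proof -
  obtain m :: nat and a b where "t = (\<Sum>i<m. a i \<otimes> b i)"
    using assms by (auto simp: alg_tensor_def)
  moreover from this have "mult_tensor t = (\<Sum>i<m. a i * b i)" by (simp only: mult_tensor_sum)
  ultimately show ?thesis
    by (simp add: sum_fun_apply tens_def bilinear_form_cinner cop_sum_left cinner_sum_right
        times_cop.rep_eq)
qed

lemma mult_tensor_add:
  "s \<in> alg_tensor S T \<Longrightarrow> t \<in> alg_tensor S T \<Longrightarrow> mult_tensor (s + t) = mult_tensor s + mult_tensor t"
  by (rule mult_tensor_eqI) (simp add: cinner_mult_tensor plus_cop.rep_eq cinner_add_right)

lemma mult_tensor_scaleC:
  "t \<in> alg_tensor S T \<Longrightarrow> mult_tensor (c *\<^sub>C t) = c *\<^sub>C mult_tensor t"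
  by (rule mult_tensor_eqI) (simp add: cinner_mult_tensor scaleC_cop.rep_eq scaleC_fun_def
      scaleC_complex_def cinner_scaleC_right)

text \<open>Moving c past b in (a c)(b d) = (a b)(c d) is where A commutes with A'.\<close>

lemma mult_tensor_tmult:
  assumes "s \<in> alg_tensor A (commutant A)" "t \<in> alg_tensor A (commutant A)"
  shows "mult_tensor (tmult s t) = mult_tensor s * mult_tensor t"
proof -
  obtain m :: nat and a b where s: "s = (\<Sum>i<m. a i \<otimes> b i)" "\<And>i. i < m \<Longrightarrow> b i \<in> commutant A"
    using assms(1) by (auto simp: alg_tensor_def)
  obtain n :: nat and c d where t: "t = (\<Sum>j<n. c j \<otimes> d j)" "\<And>j. j < n \<Longrightarrow> c j \<in> A"
    using assms(2) by (auto simp: alg_tensor_def)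
  have "tmult s t = (\<Sum>(i, j)\<in>{..<m} \<times> {..<n}. (a i * c j) \<otimes> (b i * d j))"
    by (simp add: s t tmult_sum sum.cartesian_product)
  then have "mult_tensor (tmult s t) = (\<Sum>(i, j)\<in>{..<m} \<times> {..<n}. (a i * c j) * (b i * d j))"
    using mult_tensor_sum[of "\<lambda>(i, j). a i * c j" "\<lambda>(i, j). b i * d j"]
    by (simp add: case_prod_beta)
  also have "\<dots> = (\<Sum>(i, j)\<in>{..<m} \<times> {..<n}. (a i * b i) * (c j * d j))"
  proof (rule sum.cong, rule refl, clarify)
    fix i j assume "i < m" "j < n"
    then have "c j * b i = b i * c j" using s(2) t(2) by (auto simp: commutant_def)
    then show "a i * c j * (b i * d j) = a i * b i * (c j * d j)" by (metis mult.assoc)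
  qed
  also have "\<dots> = mult_tensor s * mult_tensor t"
    by (simp add: s(1) t(1) mult_tensor_sum sum_product sum.cartesian_product)
  finally show ?thesis .
qed

lemma adj_sum: "adj (\<Sum>i\<in>I. a i) = (\<Sum>i\<in>I. adj (a i))"
  by (induction I rule: infinite_finite_induct) (auto simp: adj_add adj_zero)

text \<open>The adjoint reverses a b, and commutation of A with A' restores the order.\<close>

lemma mult_tensor_tstar:
  assumes "t \<in> alg_tensor A (commutant A)"
  shows "mult_tensor (tstar t) = adj (mult_tensor t)"
proof -
  obtain m :: nat and a b where t: "t = (\<Sum>i<m. a i \<otimes> b i)"
      "\<And>i. i < m \<Longrightarrow> a i \<in> A" "\<And>i. i < m \<Longrightarrow> b i \<in> commutant A"
    using assms by (auto simp: alg_tensor_def)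
  then have "b i * a i = a i * b i" if "i < m" for i using that by (auto simp: commutant_def)
  then show ?thesis
    by (simp add: t(1) tstar_sum mult_tensor_sum adj_sum flip: adj_mult)
qed

section \<open>Hilbert spaces given by carriers\<close>

lemma scaleC_minus_one: "(- 1) *\<^sub>C x = - (x :: 'h::complex_vector)"
proof -
  have "0 *\<^sub>C x = 0" using scaleC_add_left[of 0 0 x] by simp
  then have "(- 1) *\<^sub>C x + x = 0" using scaleC_add_left[of "- 1" 1 x] by (simp add: scaleC_one)
  then show ?thesis by (rule eq_neg_iff_add_eq_0[THEN iffD2])
qed

text \<open>The space of a cyclic representation is a subset of a type whose class supplies no norm;
  inner product calculus and limits are developed relative to membership in H, with convergence
  expressed through \<open>hdist\<close>.\<close>

locale hilbert_carrier =
  fixes H :: "'h::complex_vector set" and ip :: "'h \<Rightarrow> 'h \<Rightarrow> complex"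
  assumes hilbert: "hilbert_on H ip"
begin

lemma zero_in [simp]: "0 \<in> H"
  and add_in [simp]: "x \<in> H \<Longrightarrow> y \<in> H \<Longrightarrow> x + y \<in> H"
  and scaleC_in [simp]: "x \<in> H \<Longrightarrow> c *\<^sub>C x \<in> H"
  using hilbert by (auto simp: hilbert_on_def csubspace_def)

lemma minus_in [simp]: "x \<in> H \<Longrightarrow> - x \<in> H"
  using scaleC_in[of x "- 1"] by (simp add: scaleC_minus_one)

lemma diff_in [simp]: "x \<in> H \<Longrightarrow> y \<in> H \<Longrightarrow> x - y \<in> H"
  using add_in[of x "- y"] by simp

lemma ip_commute: "x \<in> H \<Longrightarrow> y \<in> H \<Longrightarrow> ip x y = cnj (ip y x)"
  and ip_clinear: "x \<in> H \<Longrightarrow> clinear_on H (ip x)"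
  and ip_self: "x \<in> H \<Longrightarrow> ip x x \<in> \<real>\<^sub>\<ge>\<^sub>0 \<and> (ip x x = 0 \<longrightarrow> x = 0)"
  using hilbert unfolding hilbert_on_def by blast+

lemma ip_add_right: "x \<in> H \<Longrightarrow> y \<in> H \<Longrightarrow> z \<in> H \<Longrightarrow> ip x (y + z) = ip x y + ip x z"
  and ip_scaleC_right: "x \<in> H \<Longrightarrow> y \<in> H \<Longrightarrow> ip x (c *\<^sub>C y) = c * ip x y"
  using ip_clinear[of x] by (simp_all add: clinear_on_def scaleC_complex_def)

lemma ip_add_left: "x \<in> H \<Longrightarrow> y \<in> H \<Longrightarrow> z \<in> H \<Longrightarrow> ip (x + y) z = ip x z + ip y z"
  by (simp add: ip_commute[of _ z] ip_add_right)

lemma ip_scaleC_left: "x \<in> H \<Longrightarrow> y \<in> H \<Longrightarrow> ip (c *\<^sub>C x) y = cnj c * ip x y"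
  by (simp add: ip_commute[of _ y] ip_scaleC_right)

lemma ip_diff_right: "x \<in> H \<Longrightarrow> y \<in> H \<Longrightarrow> z \<in> H \<Longrightarrow> ip x (y - z) = ip x y - ip x z"
  using ip_add_right[of x y "- z"] ip_scaleC_right[of x z "- 1"]
  by (simp add: scaleC_minus_one)

lemma ip_diff_left: "x \<in> H \<Longrightarrow> y \<in> H \<Longrightarrow> z \<in> H \<Longrightarrow> ip (x - y) z = ip x z - ip y z"
  by (simp add: ip_commute[of _ z] ip_diff_right)

lemma Re_ip_nonneg: "x \<in> H \<Longrightarrow> 0 \<le> Re (ip x x)"
  using ip_self by (simp add: complex_nonneg_Reals_iff)

lemma ip_self_eq_0: "x \<in> H \<Longrightarrow> ip x x = 0 \<Longrightarrow> x = 0"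
  using ip_self by simp

lemma ip_self_eq_0_Re: "x \<in> H \<Longrightarrow> Re (ip x x) = 0 \<Longrightarrow> x = 0"
  using ip_self[of x] by (simp add: complex_nonneg_Reals_iff complex_eq_iff)

lemma hdist_sq: "x \<in> H \<Longrightarrow> y \<in> H \<Longrightarrow> (hdist ip x y)\<^sup>2 = Re (ip (x - y) (x - y))"
  by (simp add: hdist_def Re_ip_nonneg)

lemma hdist_nonneg: "x \<in> H \<Longrightarrow> y \<in> H \<Longrightarrow> 0 \<le> hdist ip x y"
  by (simp add: hdist_def Re_ip_nonneg)

lemma hdist_self: "x \<in> H \<Longrightarrow> hdist ip x x = 0"
  using ip_scaleC_right[of 0 0 0] by (simp add: hdist_def scaleC_zero_right)

text \<open>The gap between the two sides is |x + y - 2 z|^2, by the parallelogram law. This squared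
  form replaces the triangle inequality in the Cauchy estimate for surjectivity of the extended
  isometry.\<close>

lemma hdist_sq_triangle:
  assumes "x \<in> H" "y \<in> H" "z \<in> H"
  shows "(hdist ip x y)\<^sup>2 \<le> 2 * (hdist ip z x)\<^sup>2 + 2 * (hdist ip z y)\<^sup>2"
proof -
  have "0 \<le> Re (ip (x + y - z - z) (x + y - z - z))" using assms by (intro Re_ip_nonneg) simp
  then show ?thesis using assms
    by (simp add: hdist_sq ip_add_left ip_add_right ip_diff_left ip_diff_right)
qed

lemma Re_ip_cauchy_schwarz:
  assumes "x \<in> H" "y \<in> H"
  shows "\<bar>Re (ip x y)\<bar> \<le> hdist ip x 0 * hdist ip y 0"
proof -
  define r where "r = Re (ip x y)"
  define a b where "a = Re (ip x x)" and "b = Re (ip y y)"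
  have yx: "Re (ip y x) = r" using ip_commute[OF assms] by (simp add: r_def)
  have ab: "a \<ge> 0" "b \<ge> 0" using assms by (auto simp: a_def b_def Re_ip_nonneg)
  have "r\<^sup>2 \<le> a * b"
  proof (cases "b = 0")
    case True
    then have "y = 0" using assms ip_self_eq_0_Re by (simp add: b_def)
    then have "r = 0" using ip_scaleC_right[of x 0 0] assms by (simp add: r_def scaleC_zero_right)
    then show ?thesis using True by simp
  next
    case False
    \<comment> \<open>b times the residue of projecting x onto the real line through y; scaling by b
      avoids a division.\<close>
    define w where "w = complex_of_real b *\<^sub>C x - complex_of_real r *\<^sub>C y"
    have "0 \<le> Re (ip w w)" unfolding w_def using assms by (intro Re_ip_nonneg) simp
    also have "Re (ip w w) = b * (a * b - r\<^sup>2)"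
      unfolding w_def using assms
      by (simp add: ip_diff_left ip_diff_right ip_scaleC_left ip_scaleC_right yx
          r_def[symmetric] a_def[symmetric] b_def[symmetric] power2_eq_square algebra_simps)
    finally show ?thesis using ab False by (simp add: zero_le_mult_iff)
  qed
  then have "sqrt (r\<^sup>2) \<le> sqrt (a * b)" by (rule real_sqrt_le_mono)
  then show ?thesis by (simp add: hdist_def real_sqrt_mult r_def a_def b_def)
qed

text \<open>Real and imaginary parts are estimated separately, the latter by replacing y with
  \<open>\<i> *\<^sub>C y\<close>; hence the factor 2, harmless for continuity.\<close>

lemma ip_bound:
  assumes "x \<in> H" "y \<in> H"
  shows "cmod (ip x y) \<le> 2 * (hdist ip x 0 * hdist ip y 0)"
proof -
  have "Re (ip x (\<i> *\<^sub>C y)) = - Im (ip x y)" using assms by (simp add: ip_scaleC_right)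
  moreover have "hdist ip (\<i> *\<^sub>C y) 0 = hdist ip y 0"
    using assms by (simp add: hdist_def ip_scaleC_right ip_scaleC_left)
  ultimately have "\<bar>Im (ip x y)\<bar> \<le> hdist ip x 0 * hdist ip y 0"
    using Re_ip_cauchy_schwarz[of x "\<i> *\<^sub>C y"] assms by simp
  then show ?thesis
    using Re_ip_cauchy_schwarz[OF assms] cmod_le[of "ip x y"] by linarith
qed

lemma tendsto_ip:
  assumes "\<And>n. Y n \<in> H" "y \<in> H" "z \<in> H" "(\<lambda>n. hdist ip (Y n) y) \<longlonglongrightarrow> 0"
  shows "(\<lambda>n. ip (Y n) z) \<longlonglongrightarrow> ip y z"
proof (rule Lim_null_comparison[THEN LIM_zero_cancel])
  have "cmod (ip (Y n) z - ip y z) \<le> 2 * (hdist ip (Y n) y * hdist ip z 0)" for n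
    using ip_bound[of "Y n - y" z] assms by (simp add: ip_diff_left hdist_def)
  then show "\<forall>\<^sub>F n in sequentially.
      norm (ip (Y n) z - ip y z) \<le> 2 * (hdist ip (Y n) y * hdist ip z 0)" by simp
  show "(\<lambda>n. 2 * (hdist ip (Y n) y * hdist ip z 0)) \<longlonglongrightarrow> 0"
    using tendsto_mult_left[OF tendsto_mult_right[OF assms(4)], of 2 "hdist ip z 0"] by simp
qed

section \<open>Completeness, isometries and their extension from dense families\<close>

lemma complete:
  assumes "\<And>n. X n \<in> H" "\<And>e. e > 0 \<Longrightarrow> \<exists>N. \<forall>i\<ge>N. \<forall>j\<ge>N. hdist ip (X i) (X j) < e"
  shows "\<exists>x\<in>H. (\<lambda>n. hdist ip (X n) x) \<longlonglongrightarrow> 0"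
proof -
  have "range X \<subseteq> H" using assms(1) by blast
  then show ?thesis using hilbert assms(2) unfolding hilbert_on_def by blast
qed

text \<open>Expanding the squared length of u (x + y) - u x - u y involves only products of values
  of u, so it equals the same expression without u, which is 0. Linearity therefore need not be
  tracked when u is built by limits.\<close>

lemma isometry_clinear:
  fixes u :: "'a::chilbert_space \<Rightarrow> 'h"
  assumes "\<And>x. u x \<in> H" "\<And>x y. ip (u x) (u y) = cinner x y"
  shows "clinear_on UNIV u"
  unfolding clinear_on_def
proof (intro conjI ballI allI)
  fix x y c
  have "ip (u (x + y) - (u x + u y)) (u (x + y) - (u x + u y)) = 0"
    by (simp add: assms ip_add_left ip_add_right ip_diff_left ip_diff_right cinner_add_left
        cinner_add_right)
  then have "u (x + y) - (u x + u y) = 0" by (rule ip_self_eq_0[rotated]) (simp add: assms)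
  then show "u (x + y) = u x + u y" by simp
  have "ip (u (c *\<^sub>C x) - c *\<^sub>C u x) (u (c *\<^sub>C x) - c *\<^sub>C u x) = 0"
    by (simp add: assms ip_scaleC_left ip_scaleC_right ip_diff_left ip_diff_right
        cinner_scaleC_left cinner_scaleC_right)
  then have "u (c *\<^sub>C x) - c *\<^sub>C u x = 0" by (rule ip_self_eq_0[rotated]) (simp add: assms)
  then show "u (c *\<^sub>C x) = c *\<^sub>C u x" by simp
qed

lemma isometry_inj:
  fixes u :: "'a::chilbert_space \<Rightarrow> 'h"
  assumes "\<And>x y. ip (u x) (u y) = cinner x y"
  shows "inj u"
proof (rule injI)
  fix x y assume "u x = u y"
  then have "cinner z x = cinner z y" for z by (metis assms)
  then show "x = y" by (rule cinner_eqI)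
qed

text \<open>Equal Gram matrices make f t \<mapsto> g t well defined and isometric; density and
  completeness on both sides extend it to a unitary. Uniqueness of the GNS construction is the case
  where t is a tensor, f t its action on v and g t its action on \<Omega>.\<close>

lemma isometry_extension:
  fixes f :: "'i \<Rightarrow> 'a::chilbert_space" and g :: "'i \<Rightarrow> 'h"
  assumes g: "\<And>t. t \<in> T \<Longrightarrow> g t \<in> H"
    and iso: "\<And>s t. s \<in> T \<Longrightarrow> t \<in> T \<Longrightarrow> ip (g s) (g t) = cinner (f s) (f t)"
    and f_dense: "closure (f ` T) = UNIV" and g_dense: "hclosure H ip (g ` T) = H"
  obtains u where "\<And>x y. ip (u x) (u y) = cinner x y" "range u = H"
    "\<And>t. t \<in> T \<Longrightarrow> u (f t) = g t"
proof -
  have dist_eq: "hdist ip (g s) (g t) = norm (f s - f t)" if "s \<in> T" "t \<in> T" for s t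
  proof -
    have "(hdist ip (g s) (g t))\<^sup>2 = Re (cinner (f s - f t) (f s - f t))"
      using that by (simp add: hdist_sq g iso ip_diff_left ip_diff_right cinner_diff_left
          cinner_diff_right)
    also have "\<dots> = (norm (f s - f t))\<^sup>2" by (simp add: cinner_self)
    finally show ?thesis using that by (simp add: g hdist_nonneg power2_eq_iff_nonneg)
  qed
  \<comment> \<open>The graph of the closure of f t \<mapsto> g t, described by sequences of indices
    that approximate on both sides at once.\<close>
  define R where "R x y \<longleftrightarrow> y \<in> H \<and>
    (\<exists>X. (\<forall>n. X n \<in> T) \<and> (\<lambda>n. f (X n)) \<longlonglongrightarrow> x \<and> (\<lambda>n. hdist ip (g (X n)) y) \<longlonglongrightarrow> 0)" for x y
  have R_g: "ip y (g t) = cinner x (f t)" if R: "R x y" and t: "t \<in> T" for x y t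
  proof -
    obtain X where X: "\<And>n. X n \<in> T" "(\<lambda>n. f (X n)) \<longlonglongrightarrow> x" "(\<lambda>n. hdist ip (g (X n)) y) \<longlonglongrightarrow> 0"
      and y: "y \<in> H"
      using R by (auto simp: R_def)
    have "(\<lambda>n. ip (g (X n)) (g t)) \<longlonglongrightarrow> ip y (g t)"
      using X y t by (intro tendsto_ip) (auto simp: g)
    moreover have "(\<lambda>n. ip (g (X n)) (g t)) \<longlonglongrightarrow> cinner x (f t)"
      using X t by (simp add: iso) (intro tendsto_intros)
    ultimately show ?thesis by (rule LIMSEQ_unique)
  qed
  \<comment> \<open>The isometry identity passes to the limit in one variable at a time;
    \<open>R_g\<close> has already dealt with the other.\<close>
  have R_iso: "ip y z = cinner x w" if R: "R x y" and R': "R w z" for x y w z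
  proof -
    obtain X where X: "\<And>n. X n \<in> T" "(\<lambda>n. f (X n)) \<longlonglongrightarrow> x" "(\<lambda>n. hdist ip (g (X n)) y) \<longlonglongrightarrow> 0"
      and y: "y \<in> H"
      using R by (auto simp: R_def)
    have z: "z \<in> H" using R' by (simp add: R_def)
    have "ip (g (X n)) z = cinner (f (X n)) w" for n
      using R_g[OF R' X(1)[of n]] ip_commute[OF g[OF X(1)[of n]] z] cinner_commute[of "f (X n)" w]
      by simp
    then have "(\<lambda>n. cinner (f (X n)) w) \<longlonglongrightarrow> ip y z"
      using tendsto_ip[of "\<lambda>n. g (X n)" y z] X y z by (simp add: g)
    moreover have "(\<lambda>n. cinner (f (X n)) w) \<longlonglongrightarrow> cinner x w" by (intro tendsto_intros X)
    ultimately show ?thesis by (rule LIMSEQ_unique)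
  qed
  have R_unique: "y = z" if R: "R x y" and R': "R x z" for x y z
  proof -
    have "y \<in> H" "z \<in> H" using R R' by (auto simp: R_def)
    moreover from this have "ip (y - z) (y - z) = 0"
      using R R' by (simp add: ip_diff_left ip_diff_right R_iso)
    ultimately have "y - z = 0" by (intro ip_self_eq_0) simp_all
    then show ?thesis by simp
  qed
  have R_total: "\<exists>y. R x y" for x
  proof -
    have "x \<in> closure (f ` T)" by (simp add: f_dense)
    then obtain F where F: "\<And>n. F n \<in> f ` T" "F \<longlonglongrightarrow> x" by (auto simp: closure_sequential)
    then have "\<forall>n. \<exists>t\<in>T. F n = f t" by blast
    then obtain X where X: "\<And>n. X n \<in> T" "\<And>n. F n = f (X n)" by metis
    have lim: "(\<lambda>n. f (X n)) \<longlonglongrightarrow> x" using F(2) by (simp flip: X(2))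
    have "\<exists>y\<in>H. (\<lambda>n. hdist ip (g (X n)) y) \<longlonglongrightarrow> 0"
    proof (rule complete)
      show "g (X n) \<in> H" for n by (simp add: g X)
      fix e :: real assume "e > 0"
      then have "\<exists>N. \<forall>i\<ge>N. \<forall>j\<ge>N. norm (f (X i) - f (X j)) < e"
        using LIMSEQ_imp_Cauchy[OF lim] by (simp add: Cauchy_iff)
      then show "\<exists>N. \<forall>i\<ge>N. \<forall>j\<ge>N. hdist ip (g (X i)) (g (X j)) < e"
        by (simp add: dist_eq X(1))
    qed
    then show ?thesis using lim X(1) by (auto simp: R_def)
  qed
  define u where "u x = (SOME y. R x y)" for x
  have u: "R x (u x)" for x unfolding u_def by (rule someI_ex[OF R_total])
  have "u (f t) = g t" if "t \<in> T" for t
  proof (rule R_unique[OF u])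
    show "R (f t) (g t)" using that by (auto simp: R_def g hdist_self intro!: exI[of _ "\<lambda>_. t"])
  qed
  moreover have "range u = H"
  proof
    show "range u \<subseteq> H" using u by (auto simp: R_def)
    \<comment> \<open>Convergence of g (X n) to y forces f (X n) to be Cauchy, since both families
      have the same mutual distances; completeness of the source then supplies a preimage.\<close>
    show "H \<subseteq> range u"
    proof
      fix y assume y: "y \<in> H"
      then have "\<forall>e>0. \<exists>t\<in>T. hdist ip y (g t) < e"
        using g_dense unfolding hclosure_def by auto
      then have "\<exists>t\<in>T. hdist ip y (g t) < 1 / Suc n" for n by simp
      then obtain X where X: "\<And>n. X n \<in> T" "\<And>n. hdist ip y (g (X n)) < 1 / Suc n" by metis
      have sym: "hdist ip (g (X n)) y = hdist ip y (g (X n))" for n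
        using y X(1) by (simp add: hdist_def g ip_diff_left ip_diff_right)
      have lim: "(\<lambda>n. hdist ip y (g (X n))) \<longlonglongrightarrow> 0"
      proof (rule real_tendsto_sandwich)
        show "\<forall>\<^sub>F n in sequentially. 0 \<le> hdist ip y (g (X n))"
          using y X(1) by (simp add: g hdist_nonneg)
        show "\<forall>\<^sub>F n in sequentially. hdist ip y (g (X n)) \<le> inverse (real (Suc n))"
          using X(2) by (intro always_eventually allI less_imp_le) (simp add: inverse_eq_divide)
      qed (rule tendsto_const, rule LIMSEQ_inverse_real_of_nat)
      have "Cauchy (\<lambda>n. f (X n))"
      proof (rule CauchyI)
        fix e :: real assume e: "e > 0"
        then have "\<forall>\<^sub>F n in sequentially. hdist ip y (g (X n)) < e / 2"
          using order_tendstoD(2)[OF lim, of "e / 2"] by simp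
        then obtain N where N: "\<And>n. n \<ge> N \<Longrightarrow> hdist ip y (g (X n)) < e / 2"
          by (auto simp: eventually_sequentially)
        have "norm (f (X i) - f (X j)) < e" if "i \<ge> N" "j \<ge> N" for i j
        proof -
          have sq: "(hdist ip y (g (X n)))\<^sup>2 < (e / 2)\<^sup>2" if "n \<ge> N" for n
            using N[OF that] y X(1) by (intro power_strict_mono) (simp_all add: g hdist_nonneg)
          \<comment> \<open>\<open>hdist_sq_triangle\<close> contributes 2 (e/2)^2 + 2 (e/2)^2 =
            e^2, whence the choice of e/2.\<close>
          have "(norm (f (X i) - f (X j)))\<^sup>2 < e\<^sup>2"
            using hdist_sq_triangle[of "g (X i)" "g (X j)" y] sq[OF that(1)] sq[OF that(2)] y X(1)
            by (simp add: g dist_eq power_divide)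
          then show ?thesis using e by (simp add: power_less_imp_less_base)
        qed
        then show "\<exists>N. \<forall>i\<ge>N. \<forall>j\<ge>N. norm (f (X i) - f (X j)) < e" by blast
      qed
      then obtain x where "(\<lambda>n. f (X n)) \<longlonglongrightarrow> x" using Cauchy_convergent convergent_def by blast
      then have "R x y" using y X(1) lim by (auto simp: R_def sym intro!: exI[of _ X])
      then show "y \<in> range u" using R_unique[OF u] by (auto intro: range_eqI[of _ _ x])
    qed
  qed
  moreover have "ip (u x) (u y) = cinner x y" for x y by (rule R_iso[OF u u])
  ultimately show ?thesis by (intro that)
qed

end

section \<open>The diagonal transport plan\<close>

text \<open>Since A'' = A, the algebra is itself a commutant, and commutants contain 1 and are
  closed under products.\<close>

lemma von_neumann_algebra_closed:
  assumes "von_neumann_algebra A"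
  shows "1 \<in> A" "a \<in> A \<Longrightarrow> adj a \<in> A" "a \<in> A \<Longrightarrow> b \<in> A \<Longrightarrow> a * b \<in> A"
  using assms one_in_commutant[of "commutant A"] mult_in_commutant[of a "commutant A" b]
  by (auto simp: von_neumann_algebra_def)

lemma tensor_algebra_closed:
  assumes "von_neumann_algebra A" "t \<in> alg_tensor A (commutant A)"
  shows "tstar t \<in> alg_tensor A (commutant A)"
    and "s \<in> alg_tensor A (commutant A) \<Longrightarrow> tmult s t \<in> alg_tensor A (commutant A)"
proof -
  have "adj ` A \<subseteq> A" using assms(1) by (simp add: von_neumann_algebra_def)
  then show "tstar t \<in> alg_tensor A (commutant A)"
    by (intro tstar_in_alg_tensor assms(2) von_neumann_algebra_closed(2)[OF assms(1)] commutant_adj)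
  show "tmult s t \<in> alg_tensor A (commutant A)" if "s \<in> alg_tensor A (commutant A)"
    by (intro tmult_in_alg_tensor that assms(2) von_neumann_algebra_closed(3)[OF assms(1)]
        mult_in_commutant)
qed

text \<open>Linearity is immediate in this form: tensors are functionals, and this is evaluation at
  one bilinear form.\<close>

definition diagonal_plan ::
    "'a::chilbert_space \<Rightarrow> ('a cop, 'a cop) tensor \<Rightarrow> complex" where
  "diagonal_plan v t = t (\<lambda>a b. cinner v (a \<cdot> b \<cdot> v))"

lemma diagonal_plan_tens: "diagonal_plan v (a \<otimes> b) = cinner v (a \<cdot> b \<cdot> v)"
  by (simp add: diagonal_plan_def tens_def bilinear_form_cinner)

lemma diagonal_plan_mult_tensor:
  "t \<in> alg_tensor S T \<Longrightarrow> diagonal_plan v t = cinner v (mult_tensor t \<cdot> v)"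
  by (simp add: diagonal_plan_def cinner_mult_tensor)

text \<open>This is the GNS inner product of the plan. With s = t it gives positivity; in general it
  says that the orbits of \<Omega> and v have the same Gram matrix.\<close>

lemma diagonal_plan_star_mult:
  assumes "von_neumann_algebra A" "s \<in> alg_tensor A (commutant A)" "t \<in> alg_tensor A (commutant A)"
  shows "diagonal_plan v (tmult (tstar s) t) = cinner (mult_tensor s \<cdot> v) (mult_tensor t \<cdot> v)"
  using assms tensor_algebra_closed[OF assms(1)]
  by (simp add: diagonal_plan_mult_tensor[of _ A "commutant A"] mult_tensor_tmult[of _ A] mult_tensor_tstar[of _ A]
      times_cop.rep_eq cinner_adj_right)

lemma diagonal_plan_modular:
  assumes A: "von_neumann_algebra A" and \<mu>: "represents A \<mu> (\<Lambda> \<mu>)" "\<mu> 1 = 1"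
  shows "diagonal_plan (\<Lambda> \<mu>) \<in> modular_transport_plans A \<Lambda> \<mu> \<mu>"
proof -
  have one: "cinner (\<Lambda> \<mu>) (\<Lambda> \<mu>) = 1"
    using \<mu> von_neumann_algebra_closed(1)[OF A] by (simp add: represents_def one_cop.rep_eq)
  have "tensor_state A (diagonal_plan (\<Lambda> \<mu>))"
    unfolding tensor_state_def
  proof (intro conjI ballI)
    show "clinear_on (alg_tensor A (commutant A)) (diagonal_plan (\<Lambda> \<mu>))"
      by (simp add: clinear_on_def diagonal_plan_def scaleC_fun_def)
    show "diagonal_plan (\<Lambda> \<mu>) (1 \<otimes> 1) = 1" by (simp add: diagonal_plan_tens one_cop.rep_eq one)
    show "diagonal_plan (\<Lambda> \<mu>) (tmult (tstar t) t) \<in> \<real>\<^sub>\<ge>\<^sub>0" if "t \<in> alg_tensor A (commutant A)" for t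
      using that by (simp add: diagonal_plan_star_mult[OF A] cinner_self)
  qed
  moreover have "\<mu> a = cinner (\<Lambda> \<mu>) (a \<cdot> \<Lambda> \<mu>)" if "a \<in> A" for a
    using \<mu>(1) that by (simp add: represents_def)
  ultimately show ?thesis
    by (simp add: modular_transport_plans_def transport_plans_def diagonal_plan_tens one_cop.rep_eq
        is_dual_def)
qed

text \<open>The Hilbert space of the type of \<open>v\<close> already carries the representation; it is transported
  to functions on tensors, where \<^const>\<open>cost\<close> looks for it.\<close>

lemma diagonal_plan_cyclic_representation:
  fixes A :: "'a::chilbert_space cop set"
  assumes A: "von_neumann_algebra A" and v: "cyclic_vector A v"
  shows "\<exists>(H :: (('a cop, 'a cop) tensor \<Rightarrow> complex) set) ip \<pi> \<Omega>.
    cyclic_representation A (diagonal_plan v) H ip \<pi> \<Omega>"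
proof -
  define T where "T = alg_tensor A (commutant A)"
  \<comment> \<open>Each vector is encoded by its matrix coefficients against the orbit of v, which
    are linear in x because the inner product is linear in its second variable.\<close>
  define U where "U x t = (if t \<in> T then cinner (mult_tensor t \<cdot> v) x else 0)" for x t
  define V where "V = inv U"
  define ip where "ip f g = cinner (V f) (V g)" for f g
  define \<pi> where "\<pi> t f = U (mult_tensor t \<cdot> V f)" for t f
  have aT: "a \<otimes> 1 \<in> T" if "a \<in> A" for a
    unfolding T_def by (rule tens_in_alg_tensor[OF that one_in_commutant])
  \<comment> \<open>The tensors a \<otimes> 1 already determine x, because v is cyclic for
    A.\<close>
  have "inj U"
  proof (rule injI, rule cyclic_vector_eqI[OF v])
    fix x y a assume "U x = U y" "a \<in> A"
    then have "U x (a \<otimes> 1) = U y (a \<otimes> 1)" by simp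
    then show "cinner (a \<cdot> v) x = cinner (a \<cdot> v) y"
      using aT[OF \<open>a \<in> A\<close>] by (simp add: U_def mult_tensor_tens)
  qed
  then have V: "V (U x) = x" for x by (simp add: V_def)
  have U_add: "U x + U y = U (x + y)" for x y by (auto simp: U_def cinner_add_right fun_eq_iff)
  have U_diff: "U x - U y = U (x - y)" for x y by (auto simp: U_def cinner_diff_right fun_eq_iff)
  have U_scale: "c *\<^sub>C U x = U (c *\<^sub>C x)" for c x
    by (auto simp: U_def cinner_scaleC_right fun_eq_iff scaleC_fun_def scaleC_complex_def)
  have U_zero: "U 0 = 0" by (simp add: U_def fun_eq_iff)
  have ip: "ip (U x) (U y) = cinner x y" for x y by (simp add: ip_def V)
  have \<pi>: "\<pi> t (U x) = U (mult_tensor t \<cdot> x)" for t x by (simp add: \<pi>_def V)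
  have hd: "hdist ip (U x) (U y) = norm (x - y)" for x y
    by (simp add: hdist_def U_diff ip cinner_self)
  have "hilbert_on (range U) ip"
    unfolding hilbert_on_def
  proof (intro conjI allI impI ballI)
    show "csubspace (range U)"
      unfolding csubspace_def
      using U_zero by (auto simp: U_add U_scale intro: range_eqI[of _ _ 0])
    show "clinear_on (range U) (ip x)" if "x \<in> range U" for x
      using that by (auto simp: clinear_on_def U_add U_scale ip cinner_add_right
          cinner_scaleC_right scaleC_complex_def)
    show "ip x y = cnj (ip y x)" for x y unfolding ip_def by (rule cinner_commute)
    show "ip x x \<in> \<real>\<^sub>\<ge>\<^sub>0" "ip x x = 0 \<Longrightarrow> x = 0" if "x \<in> range U" for x
      using that by (auto simp: ip cinner_self U_zero)
    fix X :: "nat \<Rightarrow> ('a cop, 'a cop) tensor \<Rightarrow> complex"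
    assume X: "range X \<subseteq> range U \<and> (\<forall>e>0. \<exists>N. \<forall>i\<ge>N. \<forall>j\<ge>N. hdist ip (X i) (X j) < e)"
    define Y where "Y n = V (X n)" for n
    have XY: "X n = U (Y n)" for n
      using X unfolding Y_def V_def by (intro f_inv_into_f[symmetric]) blast
    have "Cauchy Y" using X by (simp add: Cauchy_iff XY hd)
    then obtain y where "Y \<longlonglongrightarrow> y" using Cauchy_convergent convergent_def by blast
    then have "(\<lambda>n. norm (Y n - y)) \<longlonglongrightarrow> 0" by (simp add: LIM_zero tendsto_norm_zero)
    then show "\<exists>x\<in>range U. (\<lambda>n. hdist ip (X n) x) \<longlonglongrightarrow> 0"
      by (intro bexI[of _ "U y"]) (simp_all add: XY hd)
  qed
  moreover have "\<exists>K. \<forall>x\<in>range U. hdist ip (\<pi> t x) 0 \<le> K * hdist ip x 0" for t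
  proof -
    obtain K where "\<And>x. norm (mult_tensor t \<cdot> x) \<le> norm x * K"
      using bounded_linear.bounded[OF bounded_linear_cop, of "mult_tensor t"] by blast
    then show ?thesis
      by (intro exI[of _ K]) (auto simp: \<pi> hd mult.commute simp flip: U_zero)
  qed
  moreover have "clinear_on (range U) (\<pi> t)" for t
    by (auto simp: clinear_on_def U_add U_scale \<pi> cop_add cop_scaleC)
  moreover have "clinear_on T (\<lambda>t. \<pi> t x)" for x
    by (simp add: clinear_on_def \<pi>_def T_def mult_tensor_add[of _ A "commutant A"]
        mult_tensor_scaleC[of _ A "commutant A"] plus_cop.rep_eq
        scaleC_cop.rep_eq U_add U_scale)
  moreover have "\<pi> (tmult s t) x = \<pi> s (\<pi> t x)" if "s \<in> T" "t \<in> T" for s t x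
    using that by (simp add: \<pi>_def T_def mult_tensor_tmult[of _ A] times_cop.rep_eq V)
  moreover have "ip (\<pi> t x) y = ip x (\<pi> (tstar t) y)" if "t \<in> T" for t x y
    using that by (simp add: ip_def \<pi>_def T_def mult_tensor_tstar[of _ A] V cinner_adj_right)
  moreover have "\<pi> (1 \<otimes> 1) x = x" if "x \<in> range U" for x
    using that by (auto simp: \<pi> mult_tensor_tens one_cop.rep_eq)
  moreover have "hclosure (range U) ip ((\<lambda>t. \<pi> t (U v)) ` T) = range U"
  proof -
    have "\<exists>y\<in>(\<lambda>t. \<pi> t (U v)) ` T. hdist ip (U x) y < e" if "e > 0" for x and e :: real
    proof -
      have "x \<in> closure ((\<lambda>a. a \<cdot> v) ` A)" using v by (simp add: cyclic_vector_def)
      then obtain a where "a \<in> A" "norm (a \<cdot> v - x) < e"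
        using \<open>e > 0\<close> by (auto simp: closure_approachable dist_norm)
      then show ?thesis
        by (intro bexI[of _ "\<pi> (a \<otimes> 1) (U v)"] imageI aT)
          (simp_all add: \<pi> mult_tensor_tens hd norm_minus_commute)
    qed
    then show ?thesis by (auto simp: hclosure_def)
  qed
  moreover have "diagonal_plan v t = ip (U v) (\<pi> t (U v))" if "t \<in> T" for t
    using that by (simp add: T_def diagonal_plan_mult_tensor[of _ A "commutant A"] \<pi> ip)
  ultimately have "cyclic_representation A (diagonal_plan v) (range U) ip \<pi> (U v)"
    unfolding cyclic_representation_def Let_def T_def[symmetric] by (auto simp: \<pi>_def)
  then show ?thesis by blast
qed

text \<open>The representation is arbitrary because \<open>cost\<close> selects one by choice. The
  unitary u with u (a b v) = \<open>\<pi> (a \<otimes> b) \<Omega>\<close> turns out to be the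
  target unitary, and conjugating k by it sends \<Omega> = u v to u (k v).\<close>

lemma diagonal_plan_source_target:
  assumes A: "von_neumann_algebra A" and v: "cyclic_vector A v" "separating_vector A v"
    and rep: "cyclic_representation A (diagonal_plan v) H ip \<pi> \<Omega>" and k: "k \<in> A"
  shows "source_rep A H ip \<pi> \<Omega> k \<Omega> = \<pi> (k \<otimes> 1) \<Omega>" "target_rep A v H ip \<pi> \<Omega> k \<Omega> = \<pi> (k \<otimes> 1) \<Omega>"
    "\<pi> (k \<otimes> 1) \<Omega> \<in> H"
proof -
  define T where "T = alg_tensor A (commutant A)"
  note rep' = rep[unfolded cyclic_representation_def Let_def T_def[symmetric]]
  interpret hilbert_carrier H ip by unfold_locales (use rep' in blast)
  have \<Omega>: "\<Omega> \<in> H" using rep' by blast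
  have \<pi>_in: "\<pi> t x \<in> H" if "t \<in> T" "x \<in> H" for t x using rep' that by blast
  have \<pi>_tmult: "\<pi> (tmult s t) x = \<pi> s (\<pi> t x)" if "s \<in> T" "t \<in> T" "x \<in> H" for s t x
    using rep' that by blast
  have \<pi>_adj: "ip (\<pi> t x) y = ip x (\<pi> (tstar t) y)" if "t \<in> T" "x \<in> H" "y \<in> H" for t x y
    using rep' that by blast
  have \<pi>_one: "\<pi> (1 \<otimes> 1) \<Omega> = \<Omega>" using rep' \<Omega> by blast
  have dense: "hclosure H ip ((\<lambda>t. \<pi> t \<Omega>) ` T) = H" using rep' by blast
  have state: "diagonal_plan v t = ip \<Omega> (\<pi> t \<Omega>)" if "t \<in> T" for t using rep' that by blast
  have A1: "1 \<in> A" by (rule von_neumann_algebra_closed(1)[OF A])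
  have aT: "a \<otimes> 1 \<in> T" if "a \<in> A" for a
    unfolding T_def by (rule tens_in_alg_tensor[OF that one_in_commutant])
  have bT: "1 \<otimes> b \<in> T" if "b \<in> commutant A" for b
    unfolding T_def by (rule tens_in_alg_tensor[OF A1 that])
  have iso: "ip (\<pi> s \<Omega>) (\<pi> t \<Omega>) = cinner (mult_tensor s \<cdot> v) (mult_tensor t \<cdot> v)"
    if "s \<in> T" "t \<in> T" for s t
  proof -
    have st: "tstar s \<in> T" "tmult (tstar s) t \<in> T"
      using tensor_algebra_closed[OF A] that by (auto simp: T_def)
    have "ip (\<pi> s \<Omega>) (\<pi> t \<Omega>) = ip \<Omega> (\<pi> (tmult (tstar s) t) \<Omega>)"
      using that st \<Omega> by (simp add: \<pi>_adj \<pi>_in \<pi>_tmult)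
    also have "\<dots> = diagonal_plan v (tmult (tstar s) t)" by (simp only: state st)
    finally show ?thesis using that by (simp add: T_def diagonal_plan_star_mult[OF A])
  qed
  have "UNIV = closure ((\<lambda>a. a \<cdot> v) ` A)" using v(1) by (simp add: cyclic_vector_def)
  also have "\<dots> \<subseteq> closure ((\<lambda>t. mult_tensor t \<cdot> v) ` T)"
  proof (rule closure_mono, rule image_subsetI)
    show "a \<cdot> v \<in> (\<lambda>t. mult_tensor t \<cdot> v) ` T" if "a \<in> A" for a
      by (rule image_eqI[OF _ aT[OF that]]) (simp add: mult_tensor_tens)
  qed
  finally have "closure ((\<lambda>t. mult_tensor t \<cdot> v) ` T) = UNIV" by blast
  then obtain u where u_iso: "\<And>x y. ip (u x) (u y) = cinner x y" and u_range: "range u = H"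
    and u: "\<And>t. t \<in> T \<Longrightarrow> u (mult_tensor t \<cdot> v) = \<pi> t \<Omega>"
    using isometry_extension[of T "\<lambda>t. \<pi> t \<Omega>" "\<lambda>t. mult_tensor t \<cdot> v"] \<pi>_in \<Omega> iso dense by metis
  have u_in: "u x \<in> H" for x using u_range by blast
  have inj_u: "inj u" using u_iso by (rule isometry_inj)
  have u_b: "u (b \<cdot> v) = \<pi> (1 \<otimes> b) \<Omega>" if "b \<in> commutant A" for b
    using u[OF bT[OF that]] by (simp add: mult_tensor_tens)
  have u_a: "u (a \<cdot> v) = \<pi> (a \<otimes> 1) \<Omega>" if "a \<in> A" for a
    using u[OF aT[OF that]] by (simp add: mult_tensor_tens)
  have cyc': "cyclic_vector (commutant A) v" by (rule cyclic_vector_commutant[OF A v(2)])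
  have hd: "hdist ip (u x) (u y) = norm (x - y)" for x y
  proof -
    have "ip (u x - u y) (u x - u y) = cinner (x - y) (x - y)"
      using u_in by (simp add: ip_diff_left ip_diff_right u_iso cinner_diff_left cinner_diff_right)
    then show ?thesis by (simp add: hdist_def cinner_self)
  qed
  \<comment> \<open>Cyclicity of v for A', transported by u, makes the target subspace all of H, as
    the range clause of \<open>target_unitary\<close> requires for u.\<close>
  have "hclosure H ip ((\<lambda>b. \<pi> (1 \<otimes> b) \<Omega>) ` commutant A) = H"
  proof -
    have "\<exists>y\<in>(\<lambda>b. \<pi> (1 \<otimes> b) \<Omega>) ` commutant A. hdist ip (u x) y < e" if "e > 0" for x and e :: real
    proof -
      have "x \<in> closure ((\<lambda>a. a \<cdot> v) ` commutant A)" using cyc' by (simp add: cyclic_vector_def)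
      then obtain b where "b \<in> commutant A" "norm (b \<cdot> v - x) < e"
        using \<open>e > 0\<close> by (auto simp: closure_approachable dist_norm)
      then show ?thesis
        by (intro bexI[of _ "\<pi> (1 \<otimes> b) \<Omega>"] imageI)
          (simp_all add: hd norm_minus_commute flip: u_b)
    qed
    then show ?thesis by (auto simp: hclosure_def simp flip: u_range)
  qed
  then have "target_unitary A v H ip \<pi> \<Omega> = u"
    unfolding target_unitary_def
  proof (simp only:, intro the_equality conjI allI ballI)
    show "clinear_on UNIV u" using u_in u_iso by (rule isometry_clinear)
    fix w assume w: "clinear_on UNIV w \<and> (\<forall>x y. ip (w x) (w y) = cinner x y) \<and> range w = H \<and>
      (\<forall>b\<in>commutant A. w (b \<cdot> v) = \<pi> (1 \<otimes> b) \<Omega>)"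
    show "w = u"
    proof
      fix x
      \<comment> \<open>Both ranges are H, so w x = u z; testing against the A'-orbit of v, where w
        and u agree, gives x = z.\<close>
      have "w x \<in> range u" using w u_range by blast
      then obtain z where z: "w x = u z" by blast
      have "x = z"
      proof (rule cyclic_vector_eqI[OF cyc'])
        fix b assume b: "b \<in> commutant A"
        have "cinner (b \<cdot> v) x = ip (w (b \<cdot> v)) (w x)" using w by simp
        also have "\<dots> = ip (u (b \<cdot> v)) (u z)" using w b by (simp add: z u_b)
        finally show "cinner (b \<cdot> v) x = cinner (b \<cdot> v) z" by (simp add: u_iso)
      qed
      then show "w x = u x" using z by simp
    qed
  qed (simp_all add: u_iso u_range u_b)
  moreover have "inv u \<Omega> = v"
    using u_a[OF A1] \<pi>_one inj_u by (metis inv_f_f one_cop.rep_eq)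
  ultimately show "target_rep A v H ip \<pi> \<Omega> k \<Omega> = \<pi> (k \<otimes> 1) \<Omega>"
    using u_a[OF k] by (simp add: target_rep_def)
  \<comment> \<open>\<open>source_rep\<close> is restricted to the closed orbit of \<Omega> under A
    and is \<open>undefined\<close> elsewhere, so \<Omega> has to be placed in it; b = 1 does
    this.\<close>
  have "\<exists>y\<in>(\<lambda>b. \<pi> (b \<otimes> 1) \<Omega>) ` A. hdist ip \<Omega> y < e" if "e > 0" for e :: real
    by (rule bexI[of _ \<Omega>], simp add: hdist_self \<Omega> that, rule image_eqI[OF _ A1], simp add: \<pi>_one)
  then have "\<Omega> \<in> hclosure H ip ((\<lambda>b. \<pi> (b \<otimes> 1) \<Omega>) ` A)" using \<Omega> by (simp add: hclosure_def)
  then show "source_rep A H ip \<pi> \<Omega> k \<Omega> = \<pi> (k \<otimes> 1) \<Omega>" by (simp add: source_rep_def)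
  show "\<pi> (k \<otimes> 1) \<Omega> \<in> H" by (rule \<pi>_in[OF aT[OF k] \<Omega>])
qed

section \<open>Vanishing of the cost and of the distance\<close>

lemma diagonal_plan_cost:
  fixes A :: "'a::chilbert_space cop set"
  assumes A: "von_neumann_algebra A" and v: "cyclic_vector A v" "separating_vector A v"
    and k: "\<And>l. l \<in> {1..n} \<Longrightarrow> k l \<in> A"
  shows "cost A v n k (diagonal_plan v) = 0"
proof -
  define S where "S = (SOME (H :: (('a cop, 'a cop) tensor \<Rightarrow> complex) set, ip, \<pi>, \<Omega>).
    cyclic_representation A (diagonal_plan v) H ip \<pi> \<Omega>)"
  obtain H ip \<pi> \<Omega> where S: "S = (H, ip, \<pi>, \<Omega>)" by (metis prod.exhaust)
  \<comment> \<open>The choice made in \<open>cost\<close> satisfies its predicate because a cyclic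
    representation on functions on tensors has been constructed.\<close>
  have "case S of (H, ip, \<pi>, \<Omega>) \<Rightarrow> cyclic_representation A (diagonal_plan v) H ip \<pi> \<Omega>"
    unfolding S_def by (rule someI_ex) (use diagonal_plan_cyclic_representation[OF A v(1)] in auto)
  then have rep: "cyclic_representation A (diagonal_plan v) H ip \<pi> \<Omega>" by (simp add: S)
  then interpret hilbert_carrier H ip
    by unfold_locales (simp add: cyclic_representation_def)
  have "hdist ip (source_rep A H ip \<pi> \<Omega> (k l) \<Omega>) (target_rep A v H ip \<pi> \<Omega> (k l) \<Omega>) = 0"
    if "l \<in> {1..n}" for l
    using diagonal_plan_source_target[OF A v rep k[OF that]] by (simp add: hdist_self)
  then show ?thesis unfolding cost_def S_def[symmetric] by (simp add: S)
qed

text \<open>A sum of real squares, whatever representation the choice returns; it bounds the infimum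
  from below.\<close>

lemma cost_nonneg: "0 \<le> cost A v n k \<omega>"
  by (auto simp: cost_def split: prod.split intro!: sum_nonneg)

theorem proposition6p1:
  fixes A :: "'g::chilbert_space cop set" and J :: "'g \<Rightarrow> 'g" and P :: "'g set"
    and \<Lambda> :: "('g cop \<Rightarrow> complex) \<Rightarrow> 'g" and n :: nat and k :: "nat \<Rightarrow> 'g cop"
    and \<mu> :: "'g cop \<Rightarrow> complex"
  assumes "von_neumann_algebra A" and "sigma_finite A" and "standard_form A J P"
    and "\<And>\<nu>. \<nu> \<in> faithful_normal_states A \<Longrightarrow> represents A \<nu> (\<Lambda> \<nu>)"
    and "\<And>l. l \<in> {1..n} \<Longrightarrow> k l \<in> A"
    and "\<mu> \<in> faithful_normal_states A"
  shows "W2 A \<Lambda> n k \<mu> \<mu> = 0"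
proof -
  have rep: "represents A \<mu> (\<Lambda> \<mu>)" and one: "\<mu> 1 = 1"
    using assms(4,6) by (auto simp: faithful_normal_states_def state_on_def)
  have plan: "diagonal_plan (\<Lambda> \<mu>) \<in> modular_transport_plans A \<Lambda> \<mu> \<mu>"
    by (rule diagonal_plan_modular[where \<Lambda> = \<Lambda>, OF assms(1) rep one])
  have cost: "cost A (\<Lambda> \<mu>) n k (diagonal_plan (\<Lambda> \<mu>)) = 0"
    using rep by (intro diagonal_plan_cost assms) (auto simp: represents_def)
  let ?c = "\<lambda>\<omega>. sqrt (cost A (\<Lambda> \<mu>) n k \<omega>)"
  \<comment> \<open>For an infimum of reals this direction requires the costs to be bounded below,
    and the opposite one requires the set of plans to be nonempty.\<close>
  have "(INF \<omega>\<in>modular_transport_plans A \<Lambda> \<mu> \<mu>. ?c \<omega>) \<le> ?c (diagonal_plan (\<Lambda> \<mu>))"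
    by (intro cINF_lower plan bdd_belowI[of _ 0]) (auto simp: cost_nonneg)
  moreover have "0 \<le> (INF \<omega>\<in>modular_transport_plans A \<Lambda> \<mu> \<mu>. ?c \<omega>)"
    using plan by (intro cINF_greatest) (auto simp: cost_nonneg)
  ultimately show ?thesis unfolding W2_def cost by simp
qed

end
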